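(* Let $\widehat{\mathbf{Q}}=\widehat{\mathbf{Q}}_m$, $\widehat{\mathbf{R}}=\widehat{\mathbf{R}}_m$, $\widehat{\mathbf{S}}_m$, $\widehat{\mathbf{P}}_m$ be the matrices computed by the randomized Gram-Schmidt (RGS) algorithm described in the context from the input matrix $\widehat{\mathbf{W}}\in\mathbb{R}^{n\times m}$ and the sketching matrix $\mathbf{\Theta}\in\mathbb{R}^{k\times n}$, with unit roundoffs $u_{crs}$ and $u_{fine}$. Assume that $$100\, m^{1/2} n^{3/2} u_{fine} \leq u_{crs} \leq 0.01\, m^{-1}, \qquad n\geq 100,$$ and that Assumptions (A) stated in the context hold. Let $$\Delta_m = \|\mathbf{I}_{m\times m} - \widehat{\mathbf{S}}_m^{\mathrm T}\widehat{\mathbf{S}}_m\|_{\mathrm F}, \qquad \tilde{\Delta}_m = \|\widehat{\mathbf{P}}_m - \widehat{\mathbf{S}}_m\widehat{\mathbf{R}}_m\|_{\mathrm F}/\|\widehat{\mathbf{P}}_m\|_{\mathrm F}.$$ If $\mathbf{\Theta}$ is an $\varepsilon$-embedding for $\widehat{\mathbf{Q}}$ and for $\widehat{\mathbf{W}}$, with $\varepsilon\leq 1/2$, and if $\Delta_m,\tilde{\Delta}_m\leq 0.1$, then $$(1+\varepsilon)^{-1/2}(1-\Delta_m-0.1u_{crs}) \leq \sigma_{min}(\widehat{\mathbf{Q}}) \leq \sigma_{max}(\widehat{\mathbf{Q}}) \leq (1-\varepsilon)^{-1/2}(1+\Delta_m+0.1u_{crs})$$ and $$\|\widehat{\mathbf{W}}-\widehat{\mathbf{Q}}\widehat{\mathbf{R}}\|_{\mathrm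 F} \leq 3.7\, u_{crs}\, m^{3/2}\, \|\widehat{\mathbf{W}}\|_{\mathrm F}.$$
   Context: Notation. $\|\cdot\|$ is the $\ell_2$-norm of a vector or the spectral norm of a matrix, $\|\cdot\|_{\mathrm F}$ the Frobenius norm, $\sigma_{min},\sigma_{max}$ the minimal and maximal singular values. For a matrix $\mathbf{X}$, $|\mathbf{X}|$ is the matrix of entrywise absolute values, and $\mathbf{X}\le\mathbf{Y}$ is meant entrywise. $[\mathbf{R}]_{(a:b,c)}$ denotes the vector of entries in rows $a,\dots,b$ of column $c$. $\mathbf{X}_j$ denotes the matrix made of the first $j$ columns $\mathbf{x}_1,\dots,\mathbf{x}_j$ (for $\mathbf{R}_j$: the leading $j\times j$ block). A hat, or $\mathrm{fl}(\cdot)$, denotes the quantity actually computed in finite precision arithmetic; expressions in computed quantities (such as $\Delta_m$, $\tilde\Delta_m$) are evaluated exactly. $\varepsilon$-embedding. For $\varepsilon<1$, $\mathbf{\Theta}\in\mathbb{R}^{k\times n}$ is an $\varepsilon$-embedding for a subspace $V\subset\mathbb{R}^n$ if $|\langle \mathbf{x},\mathbf{y}\rangle-\langle\mathbf{\Theta}\mathbf{x},\mathbf{\Theta}\mathbf{y}\rangle|\le\varepsilon\|\mathbf{x}\|\|\mathbf{y}\|$ for all $\mathbf{x},\mathbf{y}\in V$. It is an $\varepsilon$-embedding for a matrix if it is one for the column space of that matrix. RGS algorithm. Input: $\mathbf{W}=[\mathbf{w}_1,\dots,\mathbf{w}_m]\in\mathbb{R}^{n\times m}$ and $\mathbf{\Theta}\in\mathbb{R}^{k\times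 n}$, $m\le k\ll n$ (the actually stored input columns are denoted $\widehat{\mathbf{w}}_i$, and $\widehat{\mathbf{W}}=[\widehat{\mathbf{w}}_1,\dots,\widehat{\mathbf{w}}_m]$). Output: $\mathbf{Q}=[\mathbf{q}_1,\dots,\mathbf{q}_m]\in\mathbb{R}^{n\times m}$ and upper triangular $\mathbf{R}\in\mathbb{R}^{m\times m}$ with entries $r_{i,j}$. For $i=1,\dots,m$: (1) $\mathbf{p}_i=\mathbf{\Theta}\mathbf{w}_i$; (2) solve the $k\times(i-1)$ least-squares problem $[\mathbf{R}]_{(1:i-1,i)}=\arg\min_{\mathbf{y}}\|\mathbf{S}_{i-1}\mathbf{y}-\mathbf{p}_i\|$; (3) $\mathbf{q}'_i=\mathbf{w}_i-\mathbf{Q}_{i-1}[\mathbf{R}]_{(1:i-1,i)}$; (4) $\mathbf{s}'_i=\mathbf{\Theta}\mathbf{q}'_i$; (5) $r_{i,i}=\|\mathbf{s}'_i\|$; (6) $\mathbf{s}_i=\mathbf{s}'_i/r_{i,i}$; (7) $\mathbf{q}_i=\mathbf{q}'_i/r_{i,i}$. Here $\mathbf{S}_j=[\mathbf{s}_1,\dots,\mathbf{s}_j]$, $\mathbf{P}_j=[\mathbf{p}_1,\dots,\mathbf{p}_j]$; for $i=1$, $\mathbf{q}'_1=\mathbf{w}_1$ and $\mathbf{s}'_1=\mathbf{p}_1$. Arithmetic. The algorithm is executed in floating point arithmetic (each elementary operation satisfies $\mathrm{fl}(x\,\mathrm{op}\,y)=(x\,\mathrm{op}\,y)(1+\xi)$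 with $|\xi|$ at most the unit roundoff): Step (3) with coarse unit roundoff $u_{crs}$, all other steps with fine unit roundoff $u_{fine}$, where $u_{fine}\le u_{crs}\le 0.01/m$. Matrix-vector products are computed in the standard way. Assumptions (A). For some constant $\varepsilon_0\le 1/2$, with $D=\sqrt{1+\varepsilon_0}$: $\|\mathbf{\Theta}\|_{\mathrm F}\le\sqrt{1+\varepsilon_0}\,\sqrt{n}$; and, with $\mathbf{\Delta q}'_i:=\widehat{\mathbf{q}}'_i-(\widehat{\mathbf{w}}_i-\widehat{\mathbf{Q}}_{i-1}[\widehat{\mathbf{R}}]_{(1:i-1,i)})$ and $\mathbf{\Delta q}_i:=\widehat{\mathbf{q}}_i-\widehat{\mathbf{q}}'_i/\widehat{r}_{i,i}$, for all $1\le i\le m$: $|\mathbf{\Delta q}'_i|\le 1.02u_{crs}(|\widehat{\mathbf{w}}_i|+i|\widehat{\mathbf{Q}}_{i-1}||[\widehat{\mathbf{R}}]_{(1:i-1,i)}|)$, $\;|\mathbf{\Delta q}_i|\le u_{fine}|\widehat{\mathbf{q}}'_i/\widehat{r}_{i,i}|$, $\|\mathbf{\Theta}\mathbf{\Delta q}'_i\|\le 1.02u_{crs}D\,\big\||\widehat{\mathbf{w}}_i|+i|\widehat{\mathbf{Q}}_{i-1}||[\widehat{\mathbf{R}}]_{(1:i-1,i)}|\big\|$, $\;\|\mathbf{\Theta}\mathbf{\Delta q}_i\|\le u_{fine}D\|\widehat{\mathbf{q}}'_i/\widehat{r}_{i,i}\|$. *)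

theory Defs
  imports
    "Jordan_Normal_Form.VS_Connect"
    "Jordan_Normal_Form.Spectral_Radius"
    "HOL-Library.Multiset"
    Complex_Main
begin

definition vnorm :: "real vec \<Rightarrow> real" where
  "vnorm v = sqrt (\<Sum>i<dim_vec v. (v $ i)\<^sup>2)"

definition frob_norm :: "real mat \<Rightarrow> real" where
  "frob_norm A = sqrt (\<Sum>i<dim_row A. \<Sum>j<dim_col A. (A $$ (i, j))\<^sup>2)"

text \<open>An \<open>n \<times> m\<close> matrix has \<open>min n m\<close> singular values, namely the square roots of the
  eigenvalues of the smaller one of its two Gram matrices.\<close>

definition singular_values :: "real mat \<Rightarrow> real set" where
  "singular_values A =
     sqrt ` spectrum (if dim_col A \<le> dim_row A then A\<^sup>T * A else A * A\<^sup>T)"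

definition sigma_min :: "real mat \<Rightarrow> real" where
  "sigma_min A = Min (singular_values A)"

definition sigma_max :: "real mat \<Rightarrow> real" where
  "sigma_max A = Max (singular_values A)"

definition eps_embedding :: "real \<Rightarrow> real mat \<Rightarrow> real vec set \<Rightarrow> bool" where
  "eps_embedding \<epsilon> \<Theta> V \<longleftrightarrow> \<epsilon> < 1 \<and>
     (\<forall>x\<in>V. \<forall>y\<in>V. \<bar>x \<bullet> y - (\<Theta> *\<^sub>v x) \<bullet> (\<Theta> *\<^sub>v y)\<bar> \<le> \<epsilon> * vnorm x * vnorm y)"

definition eps_embedding_mat :: "real \<Rightarrow> real mat \<Rightarrow> real mat \<Rightarrow> bool" where
  "eps_embedding_mat \<epsilon> \<Theta> A \<longleftrightarrow>
     eps_embedding \<epsilon> \<Theta> (vec_space.col_space (dim_row A) A)"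

definition first_cols :: "real mat \<Rightarrow> nat \<Rightarrow> real mat" where
  "first_cols A j = mat (dim_row A) j (\<lambda>(r, c). A $$ (r, c))"

text \<open>Rounding is modelled as a relation: \<open>fl u x z\<close> says that \<open>z\<close> is an admissible computed
  value of an elementary operation with exact result \<open>x\<close> and unit roundoff \<open>u\<close>.\<close>

definition fl :: "real \<Rightarrow> real \<Rightarrow> real \<Rightarrow> bool" where
  "fl u x z \<longleftrightarrow> (\<exists>\<xi>. \<bar>\<xi>\<bar> \<le> u \<and> z = x * (1 + \<xi>))"

text \<open>Summation by pairwise floating point additions. The order of the additions is left open,
  so that the usual left-to-right recursion as well as blocked summation are covered.\<close>

inductive fl_sum :: "real \<Rightarrow> real multiset \<Rightarrow> real \<Rightarrow> bool" for u :: real where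
  empty: "fl_sum u {#} 0"
| single: "fl_sum u {#x#} x"
| add: "A \<noteq> {#} \<Longrightarrow> B \<noteq> {#} \<Longrightarrow> fl_sum u A a \<Longrightarrow> fl_sum u B b \<Longrightarrow> fl u (a + b) c
    \<Longrightarrow> fl_sum u (A + B) c"

definition fl_inner :: "real \<Rightarrow> real vec \<Rightarrow> real vec \<Rightarrow> real \<Rightarrow> bool" where
  "fl_inner u x y s \<longleftrightarrow>
     (\<exists>t. (\<forall>j<dim_vec y. fl u (x $ j * y $ j) (t j)) \<and>
          fl_sum u (image_mset t (mset_set {..<dim_vec y})) s)"

definition fl_mult_mat_vec :: "real \<Rightarrow> real mat \<Rightarrow> real vec \<Rightarrow> real vec \<Rightarrow> bool" where
  "fl_mult_mat_vec u A x z \<longleftrightarrow>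
     dim_vec z = dim_row A \<and> (\<forall>i<dim_row A. fl_inner u (row A i) x (z $ i))"

definition fl_minus_vec :: "real \<Rightarrow> real vec \<Rightarrow> real vec \<Rightarrow> real vec \<Rightarrow> bool" where
  "fl_minus_vec u x y z \<longleftrightarrow>
     dim_vec z = dim_vec x \<and> (\<forall>i<dim_vec x. fl u (x $ i - y $ i) (z $ i))"

definition fl_divide_vec :: "real \<Rightarrow> real vec \<Rightarrow> real \<Rightarrow> real vec \<Rightarrow> bool" where
  "fl_divide_vec u x r z \<longleftrightarrow>
     dim_vec z = dim_vec x \<and> (\<forall>i<dim_vec x. fl u (x $ i / r) (z $ i))"

definition fl_vnorm :: "real \<Rightarrow> real vec \<Rightarrow> real \<Rightarrow> bool" where
  "fl_vnorm u x r \<longleftrightarrow> (\<exists>s. fl_inner u x x s \<and> fl u (sqrt s) r)"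

text \<open>The randomized Gram-Schmidt process does not prescribe how its least-squares problems are
  solved. A solver is therefore a parameter: \<open>ls u S p y\<close> says that \<open>y\<close> is an admissible
  output for \<open>min \<parallel>S y - p\<parallel>\<close> when the solver is run with unit roundoff \<open>u\<close>. It is only
  required to be correct in exact arithmetic (\<open>u = 0\<close>); no accuracy is imposed for \<open>u > 0\<close>.\<close>

definition is_least_squares :: "real mat \<Rightarrow> real vec \<Rightarrow> real vec \<Rightarrow> bool" where
  "is_least_squares S p y \<longleftrightarrow>
     is_arg_min (\<lambda>y. vnorm (S *\<^sub>v y - p)) (\<lambda>y. y \<in> carrier_vec (dim_col S)) y"

definition least_squares_solver ::
    "(real \<Rightarrow> real mat \<Rightarrow> real vec \<Rightarrow> real vec \<Rightarrow> bool) \<Rightarrow> bool" where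
  "least_squares_solver ls \<longleftrightarrow>
     (\<forall>S p y. p \<in> carrier_vec (dim_row S) \<longrightarrow> ls 0 S p y \<longrightarrow> is_least_squares S p y)"

text \<open>The matrices \<open>P, Q', S', R, S, Q\<close> (with columns \<open>p\<^sub>i, q'\<^sub>i, s'\<^sub>i\<close> etc.) arise from a
  floating point execution on the input \<open>W\<close>, \<open>\<Theta>\<close>. Indices start at 0, so that the
  iteration \<open>i\<close> below has exactly \<open>i\<close> predecessors.\<close>

definition rgs_step ::
    "(real \<Rightarrow> real mat \<Rightarrow> real vec \<Rightarrow> real vec \<Rightarrow> bool) \<Rightarrow> real \<Rightarrow> real \<Rightarrow> real mat \<Rightarrow> real mat \<Rightarrow>
     real mat \<Rightarrow> real mat \<Rightarrow> real mat \<Rightarrow> real mat \<Rightarrow> real mat \<Rightarrow> real mat \<Rightarrow> nat \<Rightarrow> bool" where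
  "rgs_step ls u\<^sub>c\<^sub>r\<^sub>s u\<^sub>f\<^sub>i\<^sub>n\<^sub>e \<Theta> W P Q' S' R S Q i \<longleftrightarrow>
     fl_mult_mat_vec u\<^sub>f\<^sub>i\<^sub>n\<^sub>e \<Theta> (col W i) (col P i) \<and>
     (if i = 0 then col Q' i = col W i \<and> col S' i = col P i
      else
        ls u\<^sub>f\<^sub>i\<^sub>n\<^sub>e (first_cols S i) (col P i) (vec_first (col R i) i) \<and>
        (\<exists>z. fl_mult_mat_vec u\<^sub>c\<^sub>r\<^sub>s (first_cols Q i) (vec_first (col R i) i) z \<and>
             fl_minus_vec u\<^sub>c\<^sub>r\<^sub>s (col W i) z (col Q' i)) \<and>
        fl_mult_mat_vec u\<^sub>f\<^sub>i\<^sub>n\<^sub>e \<Theta> (col Q' i) (col S' i)) \<and>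
     fl_vnorm u\<^sub>f\<^sub>i\<^sub>n\<^sub>e (col S' i) (R $$ (i, i)) \<and>
     fl_divide_vec u\<^sub>f\<^sub>i\<^sub>n\<^sub>e (col S' i) (R $$ (i, i)) (col S i) \<and>
     fl_divide_vec u\<^sub>f\<^sub>i\<^sub>n\<^sub>e (col Q' i) (R $$ (i, i)) (col Q i)"

definition rgs_run ::
    "(real \<Rightarrow> real mat \<Rightarrow> real vec \<Rightarrow> real vec \<Rightarrow> bool) \<Rightarrow> real \<Rightarrow> real \<Rightarrow> nat \<Rightarrow> nat \<Rightarrow> nat \<Rightarrow>
     real mat \<Rightarrow> real mat \<Rightarrow>
     real mat \<Rightarrow> real mat \<Rightarrow> real mat \<Rightarrow> real mat \<Rightarrow> real mat \<Rightarrow> real mat \<Rightarrow> bool" where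
  "rgs_run ls u\<^sub>c\<^sub>r\<^sub>s u\<^sub>f\<^sub>i\<^sub>n\<^sub>e n m k \<Theta> W P Q' S' R S Q \<longleftrightarrow>
     \<Theta> \<in> carrier_mat k n \<and> W \<in> carrier_mat n m \<and>
     P \<in> carrier_mat k m \<and> Q' \<in> carrier_mat n m \<and> S' \<in> carrier_mat k m \<and>
     R \<in> carrier_mat m m \<and> upper_triangular R \<and>
     S \<in> carrier_mat k m \<and> Q \<in> carrier_mat n m \<and>
     (\<forall>i<m. rgs_step ls u\<^sub>c\<^sub>r\<^sub>s u\<^sub>f\<^sub>i\<^sub>n\<^sub>e \<Theta> W P Q' S' R S Q i)"

text \<open>The factor in front of \<open>\<bar>Q\<^sub>i\<^sub>-\<^sub>1\<bar> \<bar>R\<bar>\<close> is the one-based iteration number, i.e. \<open>Suc i\<close>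
  for the zero-based \<open>i\<close>. The comparison of vectors is entrywise.\<close>

definition rounding_assumptions ::
    "real \<Rightarrow> real \<Rightarrow> real \<Rightarrow> nat \<Rightarrow> nat \<Rightarrow>
     real mat \<Rightarrow> real mat \<Rightarrow> real mat \<Rightarrow> real mat \<Rightarrow> real mat \<Rightarrow> bool" where
  "rounding_assumptions \<epsilon>\<^sub>0 u\<^sub>c\<^sub>r\<^sub>s u\<^sub>f\<^sub>i\<^sub>n\<^sub>e n m \<Theta> W Q' R Q \<longleftrightarrow>
     \<epsilon>\<^sub>0 \<le> 1/2 \<and>
     frob_norm \<Theta> \<le> sqrt (1 + \<epsilon>\<^sub>0) * sqrt (real n) \<and>
     (\<forall>i<m.
        let D = sqrt (1 + \<epsilon>\<^sub>0);
            r = vec_first (col R i) i;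
            h = (1 / R $$ (i, i)) \<cdot>\<^sub>v col Q' i;
            \<Delta>q' = col Q' i - (col W i - first_cols Q i *\<^sub>v r);
            \<Delta>q = col Q i - h;
            b = map_vec abs (col W i)
                + real (Suc i) \<cdot>\<^sub>v (map_mat abs (first_cols Q i) *\<^sub>v map_vec abs r)
        in map_vec abs \<Delta>q' \<le> (1.02 * u\<^sub>c\<^sub>r\<^sub>s) \<cdot>\<^sub>v b \<and>
           map_vec abs \<Delta>q \<le> u\<^sub>f\<^sub>i\<^sub>n\<^sub>e \<cdot>\<^sub>v map_vec abs h \<and>
           vnorm (\<Theta> *\<^sub>v \<Delta>q') \<le> 1.02 * u\<^sub>c\<^sub>r\<^sub>s * D * vnorm b \<and>
           vnorm (\<Theta> *\<^sub>v \<Delta>q) \<le> u\<^sub>f\<^sub>i\<^sub>n\<^sub>e * D * vnorm h)"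

end

theory Submission
  imports Defs "HOL-Analysis.L2_Norm"
begin

text \<open>Everything is estimated column by column. Put \<open>\<eta> = n\<^sup>3\<^sup>/\<^sup>2 u\<^sub>f\<^sub>i\<^sub>n\<^sub>e \<le> u\<^sub>c\<^sub>r\<^sub>s / (100 m\<^sup>1\<^sup>/\<^sup>2)\<close>. Standard rounding analysis of
  the sketching and normalization steps gives \<open>\<parallel>s\<^sub>i - \<Theta> q\<^sub>i\<parallel> \<le> 2 \<eta>\<close> and \<open>\<parallel>q\<^sub>i\<parallel> \<le> 1.49\<close>, hence
  \<open>\<parallel>S - \<Theta> Q\<parallel>\<^sub>F \<le> 0.02 u\<^sub>c\<^sub>r\<^sub>s\<close>. Since \<open>S\<close> distorts norms by a factor between \<open>1 - \<Delta>\<^sub>m\<close> and \<open>1 + \<Delta>\<^sub>m\<close>, the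
  embedding property transfers this to \<open>Q\<close>. For the residual, \<open>\<parallel>R\<parallel>\<^sub>F\<close> is at most a constant times
  \<open>\<parallel>S R\<parallel>\<^sub>F \<le> 1.1 \<parallel>P\<parallel>\<^sub>F\<close>, and \<open>\<parallel>P\<parallel>\<^sub>F\<close> is at most a constant times \<open>\<parallel>W\<parallel>\<^sub>F\<close>, which bounds the local
  errors \<open>\<Delta>q'\<^sub>i\<close> and \<open>r\<^sub>i\<^sub>i \<Delta>q\<^sub>i\<close> that make up the columns of \<open>W - Q R\<close>. The accuracy of the
  least-squares solver enters only through \<open>\<Delta>\<^sub>m\<close> and \<open>\<Delta>t\<^sub>m\<close>.\<close>

section \<open>Euclidean norm of vectors\<close>

lemma vnorm_eq_L2_set: "vnorm v = L2_set (\<lambda>i. v $ i) {..<dim_vec v}"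
  by (simp add: vnorm_def L2_set_def)

lemma vnorm_nonneg [simp]: "0 \<le> vnorm v"
  by (simp add: vnorm_eq_L2_set L2_set_nonneg)

lemma vnorm_eq_0_iff: "vnorm v = 0 \<longleftrightarrow> (\<forall>i<dim_vec v. v $ i = 0)"
  by (auto simp: vnorm_eq_L2_set L2_set_eq_0_iff)

lemma vnorm_mono:
  assumes "dim_vec v = dim_vec w" and "\<And>i. i < dim_vec w \<Longrightarrow> \<bar>v $ i\<bar> \<le> \<bar>w $ i\<bar>"
  shows "vnorm v \<le> vnorm w"
  unfolding vnorm_def assms(1)
  by (intro real_sqrt_le_mono sum_mono) (use assms(2) in \<open>auto simp: abs_le_square_iff\<close>)

lemma vnorm_add_le:
  assumes "dim_vec v = dim_vec w"
  shows "vnorm (v + w) \<le> vnorm v + vnorm w"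
proof -
  have "vnorm (v + w) = L2_set (\<lambda>i. v $ i + w $ i) {..<dim_vec w}"
    unfolding vnorm_eq_L2_set by (rule L2_set_cong) auto
  also have "\<dots> \<le> vnorm v + vnorm w"
    unfolding vnorm_eq_L2_set assms by (rule L2_set_triangle_ineq)
  finally show ?thesis .
qed

lemma vnorm_smult: "vnorm (c \<cdot>\<^sub>v v) = \<bar>c\<bar> * vnorm v"
  by (simp add: vnorm_def power_mult_distrib sum_distrib_left[symmetric] real_sqrt_mult)

lemma vnorm_abs: "vnorm (map_vec abs v) = vnorm v"
  by (simp add: vnorm_def)

lemma vnorm_power2: "(vnorm v)\<^sup>2 = v \<bullet> v"
  by (simp add: vnorm_def scalar_prod_def sum_nonneg power2_eq_square atLeast0LessThan)

lemma vnorm_le_add_diff: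
  assumes "dim_vec v = dim_vec w"
  shows "vnorm v \<le> vnorm w + vnorm (v - w)"
proof -
  have "v = w + (v - w)" using assms by (intro eq_vecI) auto
  then show ?thesis using vnorm_add_le[of w "v - w"] by simp
qed

lemma vnorm_diff_commute:
  assumes "dim_vec v = dim_vec w"
  shows "vnorm (v - w) = vnorm (w - v)"
  by (simp add: vnorm_def assms power2_commute)

lemma vnorm_diff_triangle:
  assumes "dim_vec u = dim_vec v" "dim_vec v = dim_vec w"
  shows "vnorm (u - w) \<le> vnorm (u - v) + vnorm (v - w)"
proof -
  have "u - w = (u - v) + (v - w)" using assms by (intro eq_vecI) auto
  then show ?thesis using vnorm_add_le[of "u - v" "v - w"] assms by simp
qed

lemma abs_scalar_prod_le:
  assumes "dim_vec v = dim_vec w"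
  shows "\<bar>v \<bullet> w\<bar> \<le> vnorm v * vnorm w"
proof -
  have "\<bar>v \<bullet> w\<bar> \<le> (\<Sum>i<dim_vec w. \<bar>v $ i\<bar> * \<bar>w $ i\<bar>)"
    unfolding scalar_prod_def atLeast0LessThan abs_mult[symmetric] by (rule sum_abs)
  also have "\<dots> \<le> vnorm v * vnorm w"
    unfolding vnorm_eq_L2_set assms by (rule L2_set_mult_ineq)
  finally show ?thesis .
qed

section \<open>Frobenius norm and its submultiplicativity\<close>

lemma frob_norm_nonneg [simp]: "0 \<le> frob_norm A"
  by (simp add: frob_norm_def sum_nonneg)

lemma frob_norm_rows: "frob_norm A = L2_set (\<lambda>i. vnorm (row A i)) {..<dim_row A}"
  by (simp add: frob_norm_def L2_set_def vnorm_def sum_nonneg)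

lemma frob_norm_cols: "frob_norm A = L2_set (\<lambda>j. vnorm (col A j)) {..<dim_col A}"
  unfolding frob_norm_def L2_set_def vnorm_def
  by (subst sum.swap) (simp add: sum_nonneg)

lemma frob_norm_abs: "frob_norm (map_mat abs A) = frob_norm A"
  by (simp add: frob_norm_def)

lemma vnorm_col_le_frob_norm:
  assumes "j < dim_col A"
  shows "vnorm (col A j) \<le> frob_norm A"
  unfolding frob_norm_cols by (rule member_le_L2_set) (use assms in auto)

lemma frob_norm_first_cols_le:
  assumes "j \<le> dim_col A"
  shows "frob_norm (first_cols A j) \<le> frob_norm A"
proof -
  have "(\<Sum>b<j. (A $$ (a, b))\<^sup>2) \<le> (\<Sum>b<dim_col A. (A $$ (a, b))\<^sup>2)" for a
    by (rule sum_mono2) (use assms in auto)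
  then show ?thesis
    by (auto simp: frob_norm_def first_cols_def intro!: sum_mono)
qed

lemma vnorm_vec_first_le:
  assumes "j \<le> dim_vec v"
  shows "vnorm (vec_first v j) \<le> vnorm v"
proof -
  have "(\<Sum>i<j. (v $ i)\<^sup>2) \<le> (\<Sum>i<dim_vec v. (v $ i)\<^sup>2)"
    by (rule sum_mono2) (use assms in auto)
  then show ?thesis by (simp add: vnorm_def vec_first_def)
qed

lemma vnorm_mult_mat_vec_le:
  assumes "dim_vec x = dim_col A"
  shows "vnorm (A *\<^sub>v x) \<le> frob_norm A * vnorm x"
proof -
  have "vnorm (A *\<^sub>v x) = L2_set (\<lambda>i. \<bar>row A i \<bullet> x\<bar>) {..<dim_row A}"
    by (simp add: vnorm_eq_L2_set L2_set_def)
  also have "\<dots> \<le> L2_set (\<lambda>i. vnorm (row A i) * vnorm x) {..<dim_row A}"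
    by (rule L2_set_mono) (use assms in \<open>auto intro!: abs_scalar_prod_le\<close>)
  also have "\<dots> = frob_norm A * vnorm x"
    by (simp add: frob_norm_rows L2_set_left_distrib)
  finally show ?thesis .
qed

section \<open>Approximate isometries and real spectra of Gram matrices\<close>

text \<open>The difference of the squared norms is the quadratic form of
  \<open>1\<^sub>m m - S\<^sup>T * S\<close> at \<open>x\<close>, so Cauchy-Schwarz applies. This is
  how \<open>\<Delta>\<^sub>m\<close> controls the distortion of norms by \<open>S\<close>.\<close>

lemma gram_deviation:
  assumes "S \<in> carrier_mat k m" "x \<in> carrier_vec m"
  shows "\<bar>(vnorm x)\<^sup>2 - (vnorm (S *\<^sub>v x))\<^sup>2\<bar> \<le> frob_norm (1\<^sub>m m - S\<^sup>T * S) * (vnorm x)\<^sup>2"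
proof -
  let ?E = "1\<^sub>m m - S\<^sup>T * S"
  have "(S *\<^sub>v x) \<bullet> (S *\<^sub>v x) = x \<bullet> (S\<^sup>T *\<^sub>v (S *\<^sub>v x))"
    using assms transpose_vec_mult_scalar[OF assms(1,2), of "S *\<^sub>v x"]
    by (subst comm_scalar_prod[of x m]) (auto intro!: mult_mat_vec_carrier)
  also have "S\<^sup>T *\<^sub>v (S *\<^sub>v x) = (S\<^sup>T * S) *\<^sub>v x"
    using assms by (auto simp: assoc_mult_mat_vec[of _ m k _ m])
  finally have "(vnorm x)\<^sup>2 - (vnorm (S *\<^sub>v x))\<^sup>2 = x \<bullet> x - x \<bullet> ((S\<^sup>T * S) *\<^sub>v x)"
    by (simp add: vnorm_power2)
  also have "\<dots> = x \<bullet> (x - (S\<^sup>T * S) *\<^sub>v x)"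
    using assms by (subst scalar_prod_minus_distrib[of _ m]) auto
  also have "x - (S\<^sup>T * S) *\<^sub>v x = ?E *\<^sub>v x"
    using assms by (subst minus_mult_distrib_mat_vec[of _ m m]) auto
  finally have "\<bar>(vnorm x)\<^sup>2 - (vnorm (S *\<^sub>v x))\<^sup>2\<bar> \<le> vnorm x * vnorm (?E *\<^sub>v x)"
    using assms by (simp add: abs_scalar_prod_le)
  also have "\<dots> \<le> vnorm x * (frob_norm ?E * vnorm x)"
    by (intro mult_left_mono vnorm_mult_mat_vec_le) (use assms in auto)
  finally show ?thesis by (simp add: power2_eq_square mult_ac)
qed

lemma mat_vec_in_col_space:
  fixes A :: "real mat"
  assumes "x \<in> carrier_vec (dim_col A)"
  shows "A *\<^sub>v x \<in> vec_space.col_space (dim_row A) A"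
  using assms by (subst vec_space.col_space_eq[of A _ "dim_col A"]) (auto intro!: carrier_vecI)

text \<open>The embedding inequality is used only on the diagonal, with both vectors equal to
  \<open>A *\<^sub>v x\<close>.\<close>

lemma eps_embedding_mat_bounds:
  assumes "eps_embedding_mat \<epsilon> \<Theta> A" "x \<in> carrier_vec (dim_col A)"
  shows "\<bar>(vnorm (A *\<^sub>v x))\<^sup>2 - (vnorm (\<Theta> *\<^sub>v (A *\<^sub>v x)))\<^sup>2\<bar> \<le> \<epsilon> * (vnorm (A *\<^sub>v x))\<^sup>2"
  using assms mat_vec_in_col_space[OF assms(2)]
  unfolding eps_embedding_mat_def eps_embedding_def vnorm_power2
  by (fastforce simp: vnorm_power2[symmetric] power2_eq_square mult.assoc)

lemma col_eq_mult_unit_vec: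
  fixes A :: "'a :: semiring_1 mat"
  assumes "j < dim_col A"
  shows "A *\<^sub>v unit_vec (dim_col A) j = col A j"
  by (intro eq_vecI) (use assms in \<open>auto simp: scalar_prod_right_unit\<close>)

text \<open>The spectrum of a real matrix only contains its real eigenvalues, so nonemptiness needs symmetry;
  it guards the \<open>Min\<close> and \<open>Max\<close> in \<open>sigma_min\<close> and \<open>sigma_max\<close> against junk values.\<close>

lemma symmetric_spectrum_nonempty:
  fixes A :: "real mat"
  assumes A: "A \<in> carrier_mat m m" and sym: "A\<^sup>T = A" and "m \<noteq> 0"
  shows "spectrum A \<noteq> {}"
proof -
  let ?A = "map_mat complex_of_real A"
  have cA: "?A \<in> carrier_mat m m" using A by simp
  obtain l where l: "eigenvalue ?A l"
    using spectrum_non_empty[OF cA] \<open>m \<noteq> 0\<close> unfolding spectrum_def by auto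
  then obtain v where v: "v \<in> carrier_vec m" "v \<noteq> 0\<^sub>v m" "?A *\<^sub>v v = l \<cdot>\<^sub>v v"
    unfolding eigenvalue_def eigenvector_def using A by auto
  have cv: "conjugate v \<in> carrier_vec m" using v by simp
  have conj: "conjugate (?A *\<^sub>v v) = ?A *\<^sub>v conjugate v"
    using v(1) A by (intro eq_vecI) (auto simp: scalar_prod_def)
  \<comment> \<open>A complex eigenvalue always exists. Moving the real symmetric matrix to the
    other side of the Hermitian product shows that it equals its conjugate, so it is a real root of
    the characteristic polynomial.\<close>
  have "l * (v \<bullet>c v) = (?A *\<^sub>v v) \<bullet>c v"
    using v by simp
  also have "\<dots> = (?A\<^sup>T *\<^sub>v v) \<bullet>c v"
    using sym by (simp add: map_mat_transpose)
  also have "\<dots> = v \<bullet> (?A *\<^sub>v conjugate v)"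
    by (rule transpose_vec_mult_scalar[OF cA cv v(1)])
  also have "\<dots> = v \<bullet>c (l \<cdot>\<^sub>v v)"
    using conj v(3) by simp
  also have "\<dots> = cnj l * (v \<bullet>c v)"
    using v by (simp add: conjugate_smult_vec)
  finally have "l = cnj l"
    using conjugate_square_eq_0_vec[OF v(1)] v(2) by simp
  then obtain r where r: "l = complex_of_real r"
    by (metis Reals_cases Reals_cnj_iff)
  have "poly (char_poly ?A) l = 0"
    using eigenvalue_root_char_poly[OF cA] l by simp
  then have "poly (char_poly A) r = 0"
    unfolding of_real_hom.char_poly_hom[OF A] r by simp
  then show ?thesis
    using spectrum_root_char_poly[OF A] by auto
qed

section \<open>Rounding errors of sums, inner products and matrix-vector products\<close>

text \<open>Induction over the tree of additions. A summand meets one factor \<open>1 + u\<close>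
  per addition on its path to the root, and every such addition joins a nonempty multiset, so
  \<open>size M\<close> bounds the exponent for any order of summation.\<close>

lemma fl_sum_error:
  assumes "fl_sum u M s" and u: "0 \<le> u"
  shows "\<bar>s - sum_mset M\<bar> \<le> ((1 + u) ^ size M - 1) * sum_mset (image_mset abs M)"
  using assms(1)
proof induction
  case (add A B a b c)
  \<comment> \<open>One operand \<open>X\<close> after rounding of the sum; the other operand
    \<open>Y\<close> has size at least one and thereby pays for the additional factor. It is applied
    twice, with the roles of \<open>A\<close> and \<open>B\<close> exchanged.\<close>
  have step: "\<bar>x * (1 + \<xi>) - sum_mset X\<bar> \<le> ((1 + u) ^ size (X + Y) - 1) * sum_mset (image_mset abs X)"
    if "\<bar>x - sum_mset X\<bar> \<le> ((1 + u) ^ size X - 1) * sum_mset (image_mset abs X)"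
      and "Y \<noteq> {#}" and "\<bar>\<xi>\<bar> \<le> u" for x X Y \<xi>
  proof -
    define T where "T = sum_mset (image_mset abs X)"
    have T: "0 \<le> T" unfolding T_def by (induction X) auto
    have SX: "\<bar>sum_mset X\<bar> \<le> T" unfolding T_def by (induction X) auto
    have "\<bar>x * (1 + \<xi>) - sum_mset X\<bar> = \<bar>(x - sum_mset X) * (1 + \<xi>) + sum_mset X * \<xi>\<bar>"
      by (simp add: algebra_simps)
    also have "\<dots> \<le> \<bar>x - sum_mset X\<bar> * \<bar>1 + \<xi>\<bar> + \<bar>sum_mset X\<bar> * \<bar>\<xi>\<bar>"
      by (metis abs_mult abs_triangle_ineq)
    also have "\<dots> \<le> ((1 + u) ^ size X - 1) * T * (1 + u) + T * u"
      using that(1,3)[folded T_def] T SX u by (intro add_mono mult_mono) auto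
    also have "\<dots> = ((1 + u) ^ Suc (size X) - 1) * T"
      by (simp add: algebra_simps)
    also have "\<dots> \<le> ((1 + u) ^ size (X + Y) - 1) * T"
    proof -
      have "1 \<le> size Y" using that(2) by (simp add: Suc_le_eq nonempty_has_size)
      then show ?thesis
        using T u by (intro mult_right_mono diff_right_mono power_increasing) auto
    qed
    finally show ?thesis unfolding T_def .
  qed
  from add.hyps obtain \<xi> where \<xi>: "\<bar>\<xi>\<bar> \<le> u" "c = (a + b) * (1 + \<xi>)"
    unfolding fl_def by blast
  have "\<bar>c - sum_mset (A + B)\<bar>
      \<le> \<bar>a * (1 + \<xi>) - sum_mset A\<bar> + \<bar>b * (1 + \<xi>) - sum_mset B\<bar>"
    unfolding \<xi> by (simp add: algebra_simps)
  then show ?case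
    using step[OF add.IH(1) add.hyps(2) \<xi>(1)] step[OF add.IH(2) add.hyps(1) \<xi>(1)]
    by (simp add: algebra_simps)
qed (use u in auto)

text \<open>The summation contributes \<open>dim_vec y\<close> factors \<open>1 + u\<close>, and the
  rounding of the products contributes one more.\<close>

lemma fl_inner_error:
  assumes "fl_inner u x y s" and u: "0 \<le> u" and d: "dim_vec x = dim_vec y"
  shows "\<bar>s - x \<bullet> y\<bar> \<le> ((1 + u) ^ Suc (dim_vec y) - 1) * (map_vec abs x \<bullet> map_vec abs y)"
proof -
  let ?n = "dim_vec y"
  obtain t where t: "\<And>j. j < ?n \<Longrightarrow> fl u (x $ j * y $ j) (t j)"
    and s: "fl_sum u (image_mset t (mset_set {..<?n})) s"
    using assms(1) unfolding fl_inner_def by blast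
  define T where "T = (\<Sum>j<?n. \<bar>x $ j * y $ j\<bar>)"
  have T: "T = map_vec abs x \<bullet> map_vec abs y"
    unfolding T_def scalar_prod_def using d by (auto simp: abs_mult intro!: sum.cong)
  have t1: "\<bar>t j - x $ j * y $ j\<bar> \<le> u * \<bar>x $ j * y $ j\<bar>" if "j < ?n" for j
  proof -
    obtain \<xi> where "\<bar>\<xi>\<bar> \<le> u" "t j = x $ j * y $ j * (1 + \<xi>)"
      using t[OF \<open>j < ?n\<close>] unfolding fl_def by blast
    moreover from this(2) have "t j - x $ j * y $ j = x $ j * y $ j * \<xi>"
      by (simp add: algebra_simps)
    ultimately show ?thesis
      by (simp add: abs_mult mult.commute[of u] mult_left_mono)
  qed
  have t2: "\<bar>t j\<bar> \<le> (1 + u) * \<bar>x $ j * y $ j\<bar>" if "j < ?n" for j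
    using t1[OF that] by (simp add: algebra_simps)
  have "\<bar>s - (\<Sum>j<?n. t j)\<bar> \<le> ((1 + u) ^ ?n - 1) * (\<Sum>j<?n. \<bar>t j\<bar>)"
    using fl_sum_error[OF s u] by (simp add: sum_unfold_sum_mset image_mset.compositionality comp_def)
  also have "\<dots> \<le> ((1 + u) ^ ?n - 1) * ((1 + u) * T)"
    unfolding T_def sum_distrib_left
    using u t2 by (intro mult_left_mono sum_mono) auto
  finally have a: "\<bar>s - (\<Sum>j<?n. t j)\<bar> \<le> ((1 + u) ^ ?n - 1) * ((1 + u) * T)" .
  have "\<bar>(\<Sum>j<?n. t j) - x \<bullet> y\<bar> = \<bar>\<Sum>j<?n. t j - x $ j * y $ j\<bar>"
    by (simp add: scalar_prod_def atLeast0LessThan sum_subtractf)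
  also have "\<dots> \<le> (\<Sum>j<?n. \<bar>t j - x $ j * y $ j\<bar>)" by (rule sum_abs)
  also have "\<dots> \<le> u * T"
    unfolding T_def sum_distrib_left by (intro sum_mono) (use t1 in auto)
  finally have b: "\<bar>(\<Sum>j<?n. t j) - x \<bullet> y\<bar> \<le> u * T" .
  have "((1 + u) ^ ?n - 1) * ((1 + u) * T) + u * T = ((1 + u) ^ Suc ?n - 1) * T"
    by (simp add: algebra_simps)
  then show ?thesis using a b unfolding T[symmetric] by linarith
qed

text \<open>The entrywise error is bounded by a multiple of the product of absolute values, and
  neither the Frobenius norm nor \<open>vnorm\<close> sees the signs of entries.\<close>

lemma fl_mult_mat_vec_error:
  assumes "fl_mult_mat_vec u A x z" and u: "0 \<le> u" and d: "dim_vec x = dim_col A"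
  shows "vnorm (z - A *\<^sub>v x) \<le> ((1 + u) ^ Suc (dim_col A) - 1) * frob_norm A * vnorm x"
proof -
  let ?g = "(1 + u) ^ Suc (dim_col A) - 1"
  have g: "0 \<le> ?g" using u one_le_power[of "1 + u" "Suc (dim_col A)"] by linarith
  have z: "dim_vec z = dim_row A" "\<And>i. i < dim_row A \<Longrightarrow> fl_inner u (row A i) x (z $ i)"
    using assms(1) unfolding fl_mult_mat_vec_def by auto
  have "vnorm (z - A *\<^sub>v x) \<le> vnorm (?g \<cdot>\<^sub>v (map_mat abs A *\<^sub>v map_vec abs x))"
  proof (rule vnorm_mono)
    fix i assume "i < dim_vec (?g \<cdot>\<^sub>v (map_mat abs A *\<^sub>v map_vec abs x))"
    then have i: "i < dim_row A" by simp
    have "row (map_mat abs A) i = map_vec abs (row A i)"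
      using i by (intro eq_vecI) auto
    moreover have "0 \<le> map_vec abs (row A i) \<bullet> map_vec abs x"
      using d by (auto simp: scalar_prod_def intro!: sum_nonneg)
    ultimately show "\<bar>(z - A *\<^sub>v x) $ i\<bar> \<le> \<bar>(?g \<cdot>\<^sub>v (map_mat abs A *\<^sub>v map_vec abs x)) $ i\<bar>"
      using fl_inner_error[OF z(2)[OF i] u] i d g z(1) by (simp add: abs_mult del: power_Suc)
  qed (use z in auto)
  also have "\<dots> \<le> ?g * (frob_norm (map_mat abs A) * vnorm (map_vec abs x))"
    unfolding vnorm_smult using g d by (simp add: mult_left_mono vnorm_mult_mat_vec_le del: power_Suc)
  finally show ?thesis by (simp only: frob_norm_abs vnorm_abs mult.assoc)
qed

section \<open>From column bounds to Frobenius norms, and singular values\<close>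

text \<open>Minkowski's inequality for the sequences of column norms. One-term bounds are obtained
  with \<open>c = 0\<close>.\<close>

lemma frob_norm_le_cols:
  assumes "dim_col B = dim_col A" "dim_col C = dim_col A" and "0 \<le> b" "0 \<le> c"
    and le: "\<And>j. j < dim_col A \<Longrightarrow> vnorm (col A j) \<le> b * vnorm (col B j) + c * vnorm (col C j)"
  shows "frob_norm A \<le> b * frob_norm B + c * frob_norm C"
proof -
  have "frob_norm A \<le> L2_set (\<lambda>j. b * vnorm (col B j) + c * vnorm (col C j)) {..<dim_col A}"
    unfolding frob_norm_cols by (rule L2_set_mono) (use le in auto)
  also have "\<dots> \<le> L2_set (\<lambda>j. b * vnorm (col B j)) {..<dim_col A}
      + L2_set (\<lambda>j. c * vnorm (col C j)) {..<dim_col A}"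
    by (rule L2_set_triangle_ineq)
  also have "\<dots> = b * frob_norm B + c * frob_norm C"
    using assms(1-4) by (simp add: frob_norm_cols L2_set_right_distrib)
  finally show ?thesis .
qed

lemma frob_norm_le_const:
  assumes "\<And>j. j < dim_col A \<Longrightarrow> vnorm (col A j) \<le> c"
  shows "frob_norm A \<le> sqrt (dim_col A) * \<bar>c\<bar>"
proof -
  have "frob_norm A \<le> L2_set (\<lambda>j. c) {..<dim_col A}"
    unfolding frob_norm_cols by (rule L2_set_mono) (use assms in auto)
  then show ?thesis by (simp add: L2_set_constant)
qed

text \<open>An eigenvector \<open>x\<close> of the Gram matrix with eigenvalue \<open>l\<close>
  satisfies \<open>(vnorm (A *\<^sub>v x))\<^sup>2 = l * (vnorm x)\<^sup>2\<close>, so each singular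
  value is the stretching factor of some nonzero vector. The condition \<open>m \<le> n\<close>
  selects the Gram matrix \<open>A\<^sup>T * A\<close>.\<close>

lemma singular_value_bounds:
  assumes A: "A \<in> carrier_mat n m" and "0 < m" "m \<le> n"
    and lo: "\<And>x. x \<in> carrier_vec m \<Longrightarrow> lo * vnorm x \<le> vnorm (A *\<^sub>v x)"
    and hi: "\<And>x. x \<in> carrier_vec m \<Longrightarrow> vnorm (A *\<^sub>v x) \<le> hi * vnorm x"
  shows "lo \<le> sigma_min A" "sigma_min A \<le> sigma_max A" "sigma_max A \<le> hi"
proof -
  let ?G = "A\<^sup>T * A"
  have G: "?G \<in> carrier_mat m m" using A by simp
  have sv: "singular_values A = sqrt ` spectrum ?G"
    using A \<open>m \<le> n\<close> by (simp add: singular_values_def)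
  have sym: "?G\<^sup>T = ?G" using A by (simp add: transpose_mult[of _ m n])
  have ne: "singular_values A \<noteq> {}"
    unfolding sv using symmetric_spectrum_nonempty[OF G sym] \<open>0 < m\<close> by simp
  have fin: "finite (singular_values A)"
    unfolding sv using card_finite_spectrum[OF G] by simp
  have bd: "lo \<le> s \<and> s \<le> hi" if "s \<in> singular_values A" for s
  proof -
    obtain l where l: "s = sqrt l" "eigenvalue ?G l"
      using \<open>s \<in> singular_values A\<close> unfolding sv spectrum_def image_iff by blast
    then obtain x where x: "x \<in> carrier_vec m" "x \<noteq> 0\<^sub>v m" "?G *\<^sub>v x = l \<cdot>\<^sub>v x"
      unfolding eigenvalue_def eigenvector_def using A by auto
    have "(vnorm (A *\<^sub>v x))\<^sup>2 = (A\<^sup>T *\<^sub>v (A *\<^sub>v x)) \<bullet> x"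
      unfolding vnorm_power2 using A x(1) by (subst transpose_vec_mult_scalar[OF A]) auto
    also have "A\<^sup>T *\<^sub>v (A *\<^sub>v x) = l \<cdot>\<^sub>v x"
      unfolding x(3)[symmetric] using A x(1) by (auto simp: assoc_mult_mat_vec[of _ m n _ m])
    finally have sq: "(vnorm (A *\<^sub>v x))\<^sup>2 = l * (vnorm x)\<^sup>2"
      using x(1) by (simp add: vnorm_power2)
    have "vnorm x \<noteq> 0"
    proof
      assume "vnorm x = 0"
      then have "x = 0\<^sub>v m" using x(1) by (auto simp: vnorm_eq_0_iff intro!: eq_vecI)
      then show False using x(2) by simp
    qed
    then have pos: "0 < vnorm x" by (simp add: less_le)
    have "vnorm (A *\<^sub>v x) = sqrt ((vnorm (A *\<^sub>v x))\<^sup>2)" by simp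
    also have "\<dots> = s * vnorm x" unfolding sq l(1) by (simp add: real_sqrt_mult)
    finally have "vnorm (A *\<^sub>v x) = s * vnorm x" .
    then show ?thesis using lo[OF x(1)] hi[OF x(1)] pos by simp
  qed
  show "lo \<le> sigma_min A" unfolding sigma_min_def using bd Min_in[OF fin ne] by blast
  show "sigma_max A \<le> hi" unfolding sigma_max_def using bd Max_in[OF fin ne] by blast
  show "sigma_min A \<le> sigma_max A"
    unfolding sigma_min_def sigma_max_def using Min_le[OF fin Max_in[OF fin ne]] .
qed

section \<open>Normalization and sketching of a single column\<close>

lemma fl_divide_vec_error:
  assumes "fl_divide_vec u x r z"
  shows "vnorm (z - (1 / r) \<cdot>\<^sub>v x) \<le> \<bar>u\<bar> * vnorm ((1 / r) \<cdot>\<^sub>v x)"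
proof -
  have z: "dim_vec z = dim_vec x" "\<And>i. i < dim_vec x \<Longrightarrow> fl u (x $ i / r) (z $ i)"
    using assms unfolding fl_divide_vec_def by auto
  have "vnorm (z - (1 / r) \<cdot>\<^sub>v x) \<le> vnorm (u \<cdot>\<^sub>v ((1 / r) \<cdot>\<^sub>v x))"
  proof (rule vnorm_mono)
    fix i assume "i < dim_vec (u \<cdot>\<^sub>v ((1 / r) \<cdot>\<^sub>v x))"
    then have i: "i < dim_vec x" by simp
    obtain \<xi> where \<xi>: "\<bar>\<xi>\<bar> \<le> u" "z $ i = x $ i / r * (1 + \<xi>)"
      using z(2)[OF i] unfolding fl_def by blast
    then have "(z - (1 / r) \<cdot>\<^sub>v x) $ i = \<xi> * (x $ i / r)"
      using i z(1) by (simp add: algebra_simps add_divide_distrib)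
    then show "\<bar>(z - (1 / r) \<cdot>\<^sub>v x) $ i\<bar> \<le> \<bar>(u \<cdot>\<^sub>v ((1 / r) \<cdot>\<^sub>v x)) $ i\<bar>"
      using i \<xi>(1) by (simp add: abs_mult mult_right_mono divide_right_mono)
  qed (use z in auto)
  then show ?thesis by (simp add: vnorm_smult)
qed

text \<open>Purely relative errors keep an exact zero, and the convention \<open>1 / 0 = 0\<close>
  covers \<open>r = 0\<close>. This later rules out breakdown of the algorithm, since the columns of
  \<open>S\<close> are not zero.\<close>

lemma fl_divide_vec_zero:
  assumes "fl_divide_vec u x r z" and "vnorm x = 0 \<or> r = 0"
  shows "vnorm z = 0"
proof -
  have "vnorm ((1 / r) \<cdot>\<^sub>v x) = 0" "\<bar>u\<bar> * vnorm ((1 / r) \<cdot>\<^sub>v x) = 0" using assms(2) by (auto simp: vnorm_smult)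
  moreover have "dim_vec z = dim_vec ((1 / r) \<cdot>\<^sub>v x)"
    using assms(1) by (simp add: fl_divide_vec_def)
  ultimately show ?thesis
    using fl_divide_vec_error[OF assms(1)] vnorm_le_add_diff[of z "(1 / r) \<cdot>\<^sub>v x"]
      vnorm_nonneg[of z] by linarith
qed

text \<open>Compare with \<open>exp (real N * u)\<close>; the quadratic term of its expansion costs
  at most one percent.\<close>

lemma power_one_plus_le:
  assumes "0 \<le> u" "real N * u \<le> 1/100"
  shows "(1 + u) ^ N - 1 \<le> (101/100) * (real N * u)"
proof -
  have x: "0 \<le> real N * u" using assms(1) by simp
  have "(1 + u) ^ N \<le> exp u ^ N"
    using assms(1) by (intro power_mono) auto
  also have "\<dots> = exp (real N * u)" by (simp add: exp_of_nat_mult)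
  also have "\<dots> \<le> 1 + real N * u + (real N * u)\<^sup>2"
    using x assms(2) by (intro exp_bound) auto
  finally have "(1 + u) ^ N - 1 \<le> real N * u + (real N * u)\<^sup>2" by simp
  moreover have "(real N * u)\<^sup>2 \<le> 1/100 * (real N * u)"
    unfolding power2_eq_square using x assms(2) by (intro mult_right_mono) auto
  ultimately show ?thesis by linarith
qed

text \<open>The factor \<open>n\<close> stems from the length of the sums and \<open>sqrt n\<close>
  from the Frobenius norm of the sketching matrix. The constant rounds up 1.03 * 1.2248, where 1.03
  covers \<open>Suc n\<close> against \<open>n\<close> and the linearization of the power.\<close>

lemma fl_mult_mat_vec_error_sqrt:
  assumes fl: "fl_mult_mat_vec u A x z" and u: "0 \<le> u" and d: "dim_vec x = dim_col A"
    and n: "dim_col A = n" "100 \<le> n" and F: "frob_norm A \<le> D * sqrt n"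
    and D: "0 \<le> D" "D \<le> (12248/10000)"
    and eta: "real n * sqrt n * u \<le> 1/10000"
  shows "vnorm (z - A *\<^sub>v x) \<le> (127/100) * (real n * sqrt n * u) * vnorm x"
proof -
  let ?g = "(1 + u) ^ Suc n - 1"
  have n': "100 \<le> real n" using n(2) by simp
  have s: "1 \<le> sqrt n" using n' by simp
  have "real n * u * 1 \<le> real n * u * sqrt n" using s u by (intro mult_left_mono) auto
  then have nu: "real n * u \<le> 1/10000" using eta by (simp add: mult_ac)
  have "100 * u \<le> real n * u" using n' u by (intro mult_right_mono) auto
  then have N: "real (Suc n) * u \<le> (101/100) * (real n * u)" by (simp add: algebra_simps)
  have "?g \<le> (101/100) * (real (Suc n) * u)"
    by (rule power_one_plus_le) (use u N nu in auto)
  then have g: "?g \<le> (103/100) * (real n * u)" using N u by (simp add: algebra_simps)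
  have g0: "0 \<le> ?g" using u one_le_power[of "1 + u" "Suc n"] by linarith
  have "vnorm (z - A *\<^sub>v x) \<le> ?g * frob_norm A * vnorm x"
    using fl_mult_mat_vec_error[OF fl u d] n(1) by simp
  also have "\<dots> \<le> ((103/100) * (real n * u)) * (D * sqrt n) * vnorm x"
    using g g0 F u by (intro mult_right_mono mult_mono) auto
  also have "\<dots> = (103/100) * D * (real n * sqrt n * u) * vnorm x" by simp
  also have "\<dots> \<le> (127/100) * (real n * sqrt n * u) * vnorm x"
    using D u by (intro mult_right_mono) auto
  finally show ?thesis .
qed

text \<open>Triangle inequality along \<open>s\<close>, \<open>s' / r\<close>,
  \<open>\<Theta> *\<^sub>v h\<close>, \<open>\<Theta> *\<^sub>v q\<close>. The error
  \<open>\<delta>\<close> is relative, so scaling by \<open>1 / r\<close> preserves it whatever the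
  size of \<open>r\<close>. The factor \<open>1 - u\<close> trades the exact quotients for the
  computed vectors.\<close>

lemma sketched_column_error:
  assumes \<Theta>: "\<Theta> \<in> carrier_mat k n" and q': "q' \<in> carrier_vec n" and q: "q \<in> carrier_vec n"
    and s': "s' \<in> carrier_vec k"
    and err: "vnorm (s' - \<Theta> *\<^sub>v q') \<le> \<delta> * vnorm q'" and \<delta>: "0 \<le> \<delta>"
    and s: "fl_divide_vec u s' r s" and h: "h = (1 / r) \<cdot>\<^sub>v q'"
    and dq: "vnorm (q - h) \<le> u * vnorm h"
    and dsq: "vnorm (\<Theta> *\<^sub>v (q - h)) \<le> u * D * vnorm h"
    and u: "0 \<le> u" "u < 1" and D: "0 \<le> D"
  shows "(1 - u) * vnorm (s - \<Theta> *\<^sub>v q) \<le> u * vnorm s + (\<delta> + u * D) * vnorm q"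
    and "(1 - u) * vnorm h \<le> vnorm q"
proof -
  let ?t = "(1 / r) \<cdot>\<^sub>v s'"
  have sk: "s \<in> carrier_vec k" using s s' unfolding fl_divide_vec_def by auto
  have hn: "h \<in> carrier_vec n" using h q' by simp
  have "vnorm h \<le> vnorm q + vnorm (h - q)"
    using hn q by (intro vnorm_le_add_diff) auto
  then show hq: "(1 - u) * vnorm h \<le> vnorm q"
    using dq vnorm_diff_commute[of h q] hn q by (simp add: algebra_simps)
  have st: "vnorm (s - ?t) \<le> u * vnorm ?t" using fl_divide_vec_error[OF s] u by simp
  have "vnorm ?t \<le> vnorm s + vnorm (?t - s)"
    using sk s' by (intro vnorm_le_add_diff) auto
  then have ts: "(1 - u) * vnorm ?t \<le> vnorm s"
    using st vnorm_diff_commute[of ?t s] sk s' by (simp add: algebra_simps)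
  have "?t - \<Theta> *\<^sub>v h = (1 / r) \<cdot>\<^sub>v (s' - \<Theta> *\<^sub>v q')"
    unfolding h mult_mat_vec[OF \<Theta> q'] using s' \<Theta> by (intro eq_vecI) (auto simp: algebra_simps diff_divide_distrib)
  then have "vnorm (?t - \<Theta> *\<^sub>v h) = \<bar>1 / r\<bar> * vnorm (s' - \<Theta> *\<^sub>v q')"
    by (simp add: vnorm_smult)
  also have "\<dots> \<le> \<bar>1 / r\<bar> * (\<delta> * vnorm q')" by (intro mult_left_mono err) auto
  also have "\<dots> = \<delta> * vnorm h" by (simp add: h vnorm_smult)
  finally have th: "vnorm (?t - \<Theta> *\<^sub>v h) \<le> \<delta> * vnorm h" .
  have "\<Theta> *\<^sub>v (q - h) = \<Theta> *\<^sub>v q - \<Theta> *\<^sub>v h"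
    by (rule mult_minus_distrib_mat_vec[OF \<Theta> q hn])
  then have hqs: "vnorm (\<Theta> *\<^sub>v h - \<Theta> *\<^sub>v q) \<le> u * D * vnorm h"
    using dsq vnorm_diff_commute[of "\<Theta> *\<^sub>v h" "\<Theta> *\<^sub>v q"] \<Theta> by simp
  have "vnorm (s - \<Theta> *\<^sub>v q) \<le> vnorm (s - ?t) + vnorm (?t - \<Theta> *\<^sub>v q)"
    using sk s' \<Theta> by (intro vnorm_diff_triangle) auto
  also have "vnorm (?t - \<Theta> *\<^sub>v q) \<le> vnorm (?t - \<Theta> *\<^sub>v h) + vnorm (\<Theta> *\<^sub>v h - \<Theta> *\<^sub>v q)"
    using s' \<Theta> by (intro vnorm_diff_triangle) auto
  finally have "vnorm (s - \<Theta> *\<^sub>v q) \<le> u * vnorm ?t + (\<delta> + u * D) * vnorm h"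
    using st th hqs by (simp add: algebra_simps)
  then have "(1 - u) * vnorm (s - \<Theta> *\<^sub>v q) \<le> (1 - u) * (u * vnorm ?t + (\<delta> + u * D) * vnorm h)"
    using u by (intro mult_left_mono) auto
  also have "\<dots> = u * ((1 - u) * vnorm ?t) + (\<delta> + u * D) * ((1 - u) * vnorm h)"
    by (simp add: algebra_simps)
  also have "\<dots> \<le> u * vnorm s + (\<delta> + u * D) * vnorm q"
    using ts hq u \<delta> D by (intro add_mono mult_left_mono) auto
  finally show "(1 - u) * vnorm (s - \<Theta> *\<^sub>v q) \<le> u * vnorm s + (\<delta> + u * D) * vnorm q" .
qed

text \<open>The constants of one column, with \<open>b = \<parallel>q\<parallel>\<close>, \<open>c = \<parallel>s\<parallel>\<close>, \<open>t = \<parallel>\<Theta> q\<parallel>\<close> and \<open>e = \<parallel>s - \<Theta> q\<parallel>\<close>. The bound on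
  \<open>e\<close> involves \<open>b\<close> and vice versa, but the feedback coefficient is of order \<open>\<eta>\<close>.\<close>

lemma column_constants:
  fixes b c e t u \<eta> :: real
  assumes "0 \<le> u" "1000 * u \<le> \<eta>" "\<eta> \<le> 1/10000" and D: "0 \<le> D" "D \<le> (12248/10000)"
    and c: "0 \<le> c" "c\<^sup>2 \<le> (11/10)" and b: "0 \<le> b" and t: "0 \<le> t" "b\<^sup>2 \<le> 2 * t\<^sup>2" "t \<le> c + e"
    and e: "(1 - u) * e \<le> u * c + ((127/100) * \<eta> + u * D) * b"
  shows "b \<le> (149/100)" "e \<le> 2 * \<eta>"
proof -
  have c': "c \<le> (1049/1000)" by (rule power2_le_imp_le) (use c in \<open>auto simp: power2_eq_square\<close>)
  \<comment> \<open>The constant 1.4143 lies just above the square root of 2.\<close>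
  have bt: "b \<le> (14143/10000) * t"
  proof (rule power2_le_imp_le)
    have "((14143/10000) * t)\<^sup>2 = (200024449/100000000) * t\<^sup>2" by (simp add: power2_eq_square)
    then show "b\<^sup>2 \<le> ((14143/10000) * t)\<^sup>2" using t(2) zero_le_power2[of t] by linarith
  qed (use t in simp)
  have \<eta>: "0 \<le> \<eta>" using assms(1,2) by linarith
  have uc: "u * c \<le> u * (1049/1000)" using c' assms(1) by (rule mult_left_mono)
  have "u * D \<le> u * (12248/10000)" using D assms(1) by (intro mult_left_mono) auto
  then have "(127/100) * \<eta> + u * D \<le> (12713/10000) * \<eta>" using assms(2) \<eta> by linarith
  then have "((127/100) * \<eta> + u * D) * b \<le> (12713/10000) * (\<eta> * b)"
    using mult_right_mono[OF _ b] by (simp only: mult.assoc[symmetric])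
  then have e1: "(1 - u) * e \<le> (105/100000) * \<eta> + (12713/10000) * (\<eta> * b)"
    using e uc assms(2) \<eta> by linarith
  have e2: "e \<le> (11/10000) * \<eta> + (1272/1000) * (\<eta> * b)"
  proof (cases "e \<le> 0")
    case True
    moreover have "0 \<le> \<eta> * b" using \<eta> b by simp
    ultimately show ?thesis using \<eta> by linarith
  next
    case False
    then have "(9999/10000) * e \<le> (1 - u) * e"
      using assms(2,3) by (intro mult_right_mono) auto
    moreover have "0 \<le> \<eta> * b" using \<eta> b by simp
    ultimately show ?thesis using e1 \<eta> by argo
  qed
  \<comment> \<open>The circularity is broken here: with this crude bound the feedback is absorbed
    into \<open>b\<close>, and the resulting bound on \<open>b\<close> then gives the one on
    \<open>e\<close>.\<close>
  have "\<eta> * b \<le> 1/10000 * b" using b assms(3) by (intro mult_right_mono) auto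
  then show b': "b \<le> (149/100)" using e2 bt t(3) c' assms(3) by argo
  have "\<eta> * b \<le> \<eta> * (149/100)" using b' \<eta> by (rule mult_left_mono)
  then show "e \<le> 2 * \<eta>" using e2 \<eta> by argo
qed

section \<open>Columns of \<open>Q * R\<close>, and half-integer powers\<close>

text \<open>The sum stops at the diagonal of \<open>R\<close>. Splitting off the diagonal term
  separates the projection step from the normalization step.\<close>

lemma mult_upper_triangular_col:
  assumes Q: "Q \<in> carrier_mat n m" and R: "R \<in> carrier_mat m m" "upper_triangular R" and i: "i < m"
  shows "Q *\<^sub>v col R i
    = first_cols Q i *\<^sub>v vec_first (col R i) i + R $$ (i, i) \<cdot>\<^sub>v col Q i"
proof (intro eq_vecI)
  fix a assume "a < dim_vec (first_cols Q i *\<^sub>v vec_first (col R i) i + R $$ (i, i) \<cdot>\<^sub>v col Q i)"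
  then have a: "a < n" using Q by simp
  have "(Q *\<^sub>v col R i) $ a = (\<Sum>j<m. Q $$ (a, j) * R $$ (j, i))"
    using a Q R(1) i by (simp add: scalar_prod_def atLeast0LessThan)
  also have "\<dots> = (\<Sum>j<Suc i. Q $$ (a, j) * R $$ (j, i))"
    by (rule sum.mono_neutral_right) (use i R in \<open>auto simp: upper_triangular_def\<close>)
  also have "\<dots> = (first_cols Q i *\<^sub>v vec_first (col R i) i + R $$ (i, i) \<cdot>\<^sub>v col Q i) $ a"
    using a Q R(1) i
    by (simp add: scalar_prod_def atLeast0LessThan first_cols_def vec_first_def)
  finally show "(Q *\<^sub>v col R i) $ a = \<dots>" .
qed (use Q in \<open>auto simp: first_cols_def\<close>)

lemma abs_index_le_vnorm:
  assumes "i < dim_vec v"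
  shows "\<bar>v $ i\<bar> \<le> vnorm v"
  unfolding vnorm_eq_L2_set
  using member_le_L2_set[of "{..<dim_vec v}" i "\<lambda>i. \<bar>v $ i\<bar>"] assms
  by (simp add: L2_set_def)

lemma powr_minus_half:
  fixes x :: real
  assumes "0 < x"
  shows "x powr (-1/2) = 1 / sqrt x"
  using assms powr_minus_divide[of x "1/2"] by (simp add: powr_half_sqrt)

lemma powr_three_halves:
  fixes x :: real
  assumes "0 < x"
  shows "x powr (3/2) = x * sqrt x"
  using assms powr_add[of x 1 "1/2"] by (simp add: powr_half_sqrt)

theorem theorem3p2:
  fixes n m k :: nat
    and u\<^sub>c\<^sub>r\<^sub>s u\<^sub>f\<^sub>i\<^sub>n\<^sub>e \<epsilon> \<epsilon>\<^sub>0 \<Delta>\<^sub>m \<Delta>t\<^sub>m :: real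
    and \<Theta> W P Q' S' R S Q :: "real mat"
    and ls :: "real \<Rightarrow> real mat \<Rightarrow> real vec \<Rightarrow> real vec \<Rightarrow> bool"
  assumes "1 \<le> m" and "m \<le> k" and "k \<le> n" and "100 \<le> n"
    and "0 \<le> u\<^sub>f\<^sub>i\<^sub>n\<^sub>e"
    and "100 * real m powr (1/2) * real n powr (3/2) * u\<^sub>f\<^sub>i\<^sub>n\<^sub>e \<le> u\<^sub>c\<^sub>r\<^sub>s"
    and "u\<^sub>c\<^sub>r\<^sub>s \<le> 0.01 / real m"
    and "least_squares_solver ls"
    and "rgs_run ls u\<^sub>c\<^sub>r\<^sub>s u\<^sub>f\<^sub>i\<^sub>n\<^sub>e n m k \<Theta> W P Q' S' R S Q"
    and "rounding_assumptions \<epsilon>\<^sub>0 u\<^sub>c\<^sub>r\<^sub>s u\<^sub>f\<^sub>i\<^sub>n\<^sub>e n m \<Theta> W Q' R Q"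
    and "\<Delta>\<^sub>m = frob_norm (1\<^sub>m m - S\<^sup>T * S)"
    and "\<Delta>t\<^sub>m = frob_norm (P - S * R) / frob_norm P"
    and "eps_embedding_mat \<epsilon> \<Theta> Q" and "eps_embedding_mat \<epsilon> \<Theta> W" and "\<epsilon> \<le> 1/2"
    and "\<Delta>\<^sub>m \<le> 0.1" and "\<Delta>t\<^sub>m \<le> 0.1"
  shows "(1 + \<epsilon>) powr (-1/2) * (1 - \<Delta>\<^sub>m - 0.1 * u\<^sub>c\<^sub>r\<^sub>s) \<le> sigma_min Q \<and>
         sigma_min Q \<le> sigma_max Q \<and>
         sigma_max Q \<le> (1 - \<epsilon>) powr (-1/2) * (1 + \<Delta>\<^sub>m + 0.1 * u\<^sub>c\<^sub>r\<^sub>s) \<and>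
         frob_norm (W - Q * R) \<le> 3.7 * u\<^sub>c\<^sub>r\<^sub>s * real m powr (3/2) * frob_norm W"
proof -

  \<comment> \<open>Sizes of the roundoffs and consequences of the hypotheses\<close>
  define u where "u = u\<^sub>f\<^sub>i\<^sub>n\<^sub>e"
  define v where "v = u\<^sub>c\<^sub>r\<^sub>s"
  define \<eta> where "\<eta> = real n * sqrt n * u"
  define D where "D = sqrt (1 + \<epsilon>\<^sub>0)"
  have m: "1 \<le> real m" and n: "100 \<le> real n" and mn: "m \<le> n" "0 < m"
    using assms(1-4) by auto
  have sm: "1 \<le> sqrt m" using m by simp
  have u0: "0 \<le> u" using assms(5) by (simp add: u_def)
  have \<eta>0: "0 \<le> \<eta>" using u0 by (simp add: \<eta>_def)
  have \<eta>v: "sqrt m * \<eta> \<le> v / 100"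
    using assms(6) m n unfolding \<eta>_def u_def v_def
    by (simp add: powr_half_sqrt powr_three_halves mult_ac)
  have "1 * \<eta> \<le> sqrt m * \<eta>" using sm \<eta>0 by (rule mult_right_mono)
  then have \<eta>v': "\<eta> \<le> v / 100" using \<eta>v by linarith
  have v0: "0 \<le> v" using \<eta>v' \<eta>0 by linarith
  have "0.01 / real m \<le> 1/100" using m by (simp add: field_simps)
  then have v1: "v \<le> 1/100" using assms(7) unfolding v_def by (rule order_trans[rotated])
  have \<eta>1: "\<eta> \<le> 1/10000" using \<eta>v' v1 by linarith
  \<comment> \<open>Since \<open>100 \<le> n\<close>, the factor \<open>n * sqrt n\<close> in
    \<open>\<eta>\<close> is at least 1000.\<close>
  have "sqrt 100 \<le> sqrt n" using n by (rule real_sqrt_le_mono)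
  then have "100 * 10 * u \<le> real n * sqrt n * u"
    using n u0 by (intro mult_right_mono mult_mono) auto
  then have u\<eta>: "1000 * u \<le> \<eta>" by (simp add: \<eta>_def)
  have u1: "u < 1" using u\<eta> \<eta>1 by linarith
  have \<Theta>: "\<Theta> \<in> carrier_mat k n" and W: "W \<in> carrier_mat n m"
    and P: "P \<in> carrier_mat k m" and Q': "Q' \<in> carrier_mat n m" and S': "S' \<in> carrier_mat k m"
    and R: "R \<in> carrier_mat m m" "upper_triangular R"
    and S: "S \<in> carrier_mat k m" and Q: "Q \<in> carrier_mat n m"
    and step: "\<And>i. i < m \<Longrightarrow> rgs_step ls v u \<Theta> W P Q' S' R S Q i"
    using assms(9) unfolding rgs_run_def u_def v_def by auto
  \<comment> \<open>For \<open>i = 0\<close> the vectors \<open>col Q' 0\<close> and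
    \<open>col S' 0\<close> are copies of \<open>col W 0\<close> and \<open>col P 0\<close>, so the
    sketch of \<open>col W 0\<close> also serves as that of \<open>col Q' 0\<close>.\<close>
  have stP: "fl_mult_mat_vec u \<Theta> (col W i) (col P i)"
    and stS': "fl_mult_mat_vec u \<Theta> (col Q' i) (col S' i)"
    and stS: "fl_divide_vec u (col S' i) (R $$ (i, i)) (col S i)" if "i < m" for i
    using step[OF that] unfolding rgs_step_def by (auto split: if_splits)
  have \<Delta>1: "\<Delta>\<^sub>m \<le> 1/10" using assms(16) by simp
  have D\<epsilon>: "\<epsilon>\<^sub>0 \<le> 1/2" and F\<Theta>: "frob_norm \<Theta> \<le> D * sqrt n"
    using assms(10) unfolding rounding_assumptions_def D_def by auto
  \<comment> \<open>No lower bound on \<open>\<epsilon>\<^sub>0\<close> is given, and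
    \<open>sqrt\<close> is negative at negative arguments; the sign of \<open>D\<close> is read off
    from the Frobenius bound.\<close>
  have D0: "0 \<le> D"
  proof -
    have "0 \<le> D * sqrt n" using F\<Theta> frob_norm_nonneg order_trans by blast
    then show ?thesis using n by (simp add: zero_le_mult_iff)
  qed
  have "D \<le> sqrt (3/2)" using D\<epsilon> unfolding D_def by simp
  also have "\<dots> \<le> (12248/10000)" by (rule real_le_lsqrt) (simp_all add: power2_eq_square)
  finally have D1: "D \<le> (12248/10000)" .
  define h where "h = (\<lambda>i. (1 / R $$ (i, i)) \<cdot>\<^sub>v col Q' i)"
  define r where "r = (\<lambda>i. vec_first (col R i) i)"
  define dq' where "dq' = (\<lambda>i. col Q' i - (col W i - first_cols Q i *\<^sub>v r i))"
  define b where "b = (\<lambda>i. map_vec abs (col W i)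
    + real (Suc i) \<cdot>\<^sub>v (map_mat abs (first_cols Q i) *\<^sub>v map_vec abs (r i)))"
  have rnd: "map_vec abs (dq' i) \<le> (1.02 * v) \<cdot>\<^sub>v b i"
    "map_vec abs (col Q i - h i) \<le> u \<cdot>\<^sub>v map_vec abs (h i)"
    "vnorm (\<Theta> *\<^sub>v (col Q i - h i)) \<le> u * D * vnorm (h i)" if "i < m" for i
    using assms(10) that
    unfolding rounding_assumptions_def Let_def dq'_def b_def h_def r_def u_def v_def D_def by auto
  have le_vnorm: "vnorm x \<le> \<bar>c\<bar> * vnorm y" if "map_vec abs x \<le> c \<cdot>\<^sub>v y" for x y c
  proof -
    have "vnorm x \<le> vnorm (c \<cdot>\<^sub>v y)"
      using that by (intro vnorm_mono) (fastforce simp: less_eq_vec_def)+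
    then show ?thesis by (simp add: vnorm_smult)
  qed
  have dq: "vnorm (col Q i - h i) \<le> u * vnorm (h i)" if "i < m" for i
    using le_vnorm[OF rnd(2)[OF that]] u0 by (simp add: vnorm_abs)
  have dq'b: "vnorm (dq' i) \<le> (102/100) * v * vnorm (b i)" if "i < m" for i
    using le_vnorm[OF rnd(1)[OF that]] v0 by simp

  \<comment> \<open>Norm distortion by \<open>S\<close> and by the sketch\<close>
  have Sdev: "\<bar>(vnorm x)\<^sup>2 - (vnorm (S *\<^sub>v x))\<^sup>2\<bar> \<le> \<Delta>\<^sub>m * (vnorm x)\<^sup>2"
    if "x \<in> carrier_vec m" for x
    using gram_deviation[OF S that] assms(11) by simp
  have \<Delta>0: "0 \<le> \<Delta>\<^sub>m" using assms(11) by simp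
  have Sbd: "(9/10) * (vnorm x)\<^sup>2 \<le> (vnorm (S *\<^sub>v x))\<^sup>2" "(vnorm (S *\<^sub>v x))\<^sup>2 \<le> (11/10) * (vnorm x)\<^sup>2"
    if "x \<in> carrier_vec m" for x
  proof -
    have "\<Delta>\<^sub>m * (vnorm x)\<^sup>2 \<le> (1/10) * (vnorm x)\<^sup>2"
      using \<Delta>1 by (intro mult_right_mono) auto
    then show "(9/10) * (vnorm x)\<^sup>2 \<le> (vnorm (S *\<^sub>v x))\<^sup>2" "(vnorm (S *\<^sub>v x))\<^sup>2 \<le> (11/10) * (vnorm x)\<^sup>2"
      using Sdev[OF that] by linarith+
  qed
  have unit: "vnorm (unit_vec m i) = 1" if "i < m" for i
    using that vnorm_power2[of "unit_vec m i"] vnorm_nonneg[of "unit_vec m i"]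
    by (simp add: power2_eq_1_iff)
  \<comment> \<open>Columns are images of unit vectors, so the bounds over all coefficient vectors
    specialize to columns.\<close>
  have Scol: "S *\<^sub>v unit_vec m i = col S i" if "i < m" for i
    using col_eq_mult_unit_vec[of i S] S that by simp
  have Qcol: "Q *\<^sub>v unit_vec m i = col Q i" if "i < m" for i
    using col_eq_mult_unit_vec[of i Q] Q that by simp
  have Wcol: "W *\<^sub>v unit_vec m i = col W i" if "i < m" for i
    using col_eq_mult_unit_vec[of i W] W that by simp
  have Scol_bd: "(9/10) \<le> (vnorm (col S i))\<^sup>2" "(vnorm (col S i))\<^sup>2 \<le> (11/10)" if "i < m" for i
    using Sbd[of "unit_vec m i"] unit[OF that] Scol[OF that] by auto
  \<comment> \<open>If \<open>r\<^sub>i\<^sub>i = 0\<close>, division by zero makes the column of \<open>S\<close> vanish.\<close>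
  have Rnz: "R $$ (i, i) \<noteq> 0" if "i < m" for i
    using fl_divide_vec_zero[OF stS[OF that]] Scol_bd(1)[OF that] by auto
  \<comment> \<open>Monotonicity of \<open>sqrt\<close> holds on all reals, so the sign of
    \<open>1 + \<epsilon>\<close> can be settled later.\<close>
  have lift: "vnorm (\<Theta> *\<^sub>v x) \<le> sqrt (1 + \<epsilon>) * vnorm x" "sqrt (1 - \<epsilon>) * vnorm x \<le> vnorm (\<Theta> *\<^sub>v x)"
    if "\<bar>(vnorm x)\<^sup>2 - (vnorm (\<Theta> *\<^sub>v x))\<^sup>2\<bar> \<le> \<epsilon> * (vnorm x)\<^sup>2" for x
  proof -
    have "(vnorm (\<Theta> *\<^sub>v x))\<^sup>2 \<le> (1 + \<epsilon>) * (vnorm x)\<^sup>2" "(1 - \<epsilon>) * (vnorm x)\<^sup>2 \<le> (vnorm (\<Theta> *\<^sub>v x))\<^sup>2"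
      using that by (auto simp: algebra_simps abs_le_iff)
    then show "vnorm (\<Theta> *\<^sub>v x) \<le> sqrt (1 + \<epsilon>) * vnorm x" "sqrt (1 - \<epsilon>) * vnorm x \<le> vnorm (\<Theta> *\<^sub>v x)"
      using real_sqrt_le_mono[of "(vnorm (\<Theta> *\<^sub>v x))\<^sup>2"] real_sqrt_le_mono[of _ "(vnorm (\<Theta> *\<^sub>v x))\<^sup>2"]
      by (fastforce simp: real_sqrt_mult)+
  qed
  have embQ: "\<bar>(vnorm (Q *\<^sub>v x))\<^sup>2 - (vnorm (\<Theta> *\<^sub>v (Q *\<^sub>v x)))\<^sup>2\<bar> \<le> \<epsilon> * (vnorm (Q *\<^sub>v x))\<^sup>2"
    if "x \<in> carrier_vec m" for x
    using eps_embedding_mat_bounds[OF assms(13), of x] Q that by simp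
  have embW: "\<bar>(vnorm (W *\<^sub>v x))\<^sup>2 - (vnorm (\<Theta> *\<^sub>v (W *\<^sub>v x)))\<^sup>2\<bar> \<le> \<epsilon> * (vnorm (W *\<^sub>v x))\<^sup>2"
    if "x \<in> carrier_vec m" for x
    using eps_embedding_mat_bounds[OF assms(14), of x] W that by simp

  \<comment> \<open>Column errors and the distance of \<open>S\<close> from
    \<open>\<Theta> * Q\<close>\<close>
  have sketch: "vnorm (z - \<Theta> *\<^sub>v x) \<le> (127/100) * \<eta> * vnorm x"
    if "fl_mult_mat_vec u \<Theta> x z" "x \<in> carrier_vec n" for x z
    unfolding \<eta>_def
    by (rule fl_mult_mat_vec_error_sqrt[OF that(1) u0 _ _ assms(4) F\<Theta> D0 D1])
      (use that(2) \<Theta> \<eta>1 in \<open>auto simp: \<eta>_def\<close>)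
  have colerr: "vnorm (col Q i) \<le> (149/100)" "vnorm (col S i - \<Theta> *\<^sub>v col Q i) \<le> 2 * \<eta>"
    and hbd: "vnorm (h i) \<le> (15/10)" if i: "i < m" for i
  proof -
    have c: "col Q' i \<in> carrier_vec n" "col Q i \<in> carrier_vec n" "col S' i \<in> carrier_vec k"
      "col S i \<in> carrier_vec k"
      using Q' Q S' S i by auto
    note sk = sketched_column_error[OF \<Theta> c(1-3) sketch[OF stS'[OF i] c(1)] _ stS[OF i] _ _ _ u0 u1 D0,
        of "h i"]
    have e: "(1 - u) * vnorm (col S i - \<Theta> *\<^sub>v col Q i)
        \<le> u * vnorm (col S i) + ((127/100) * \<eta> + u * D) * vnorm (col Q i)"
      and hq: "(1 - u) * vnorm (h i) \<le> vnorm (col Q i)"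
      using sk \<eta>0 dq[OF i] rnd(3)[OF i] by (auto simp: h_def)
    have "\<epsilon> * (vnorm (col Q i))\<^sup>2 \<le> 1/2 * (vnorm (col Q i))\<^sup>2"
      using assms(15) by (intro mult_right_mono) auto
    then have t: "(vnorm (col Q i))\<^sup>2 \<le> 2 * (vnorm (\<Theta> *\<^sub>v col Q i))\<^sup>2"
      using embQ[of "unit_vec m i"] Qcol[OF i] by (auto simp: abs_le_iff)
    have t': "vnorm (\<Theta> *\<^sub>v col Q i) \<le> vnorm (col S i) + vnorm (col S i - \<Theta> *\<^sub>v col Q i)"
      using vnorm_le_add_diff[of "\<Theta> *\<^sub>v col Q i" "col S i"]
        vnorm_diff_commute[of "\<Theta> *\<^sub>v col Q i" "col S i"] \<Theta> S by simp
    show q: "vnorm (col Q i) \<le> (149/100)" "vnorm (col S i - \<Theta> *\<^sub>v col Q i) \<le> 2 * \<eta>"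
      using column_constants[OF u0 u\<eta> \<eta>1 D0 D1 vnorm_nonneg Scol_bd(2)[OF i] vnorm_nonneg
          vnorm_nonneg t t' e] by auto
    have "(999/1000) * vnorm (h i) \<le> (1 - u) * vnorm (h i)"
      using u\<eta> \<eta>1 by (intro mult_right_mono) auto
    then show "vnorm (h i) \<le> (15/10)" using hq q(1) by linarith
  qed
  \<comment> \<open>The \<open>sqrt m\<close> from collecting the columns is absorbed by the factor
    \<open>m powr (1/2)\<close> in the assumption relating the two roundoffs.\<close>
  have FE: "frob_norm (S - \<Theta> * Q) \<le> (2/100) * v"
  proof -
    have "frob_norm (S - \<Theta> * Q) \<le> sqrt (dim_col (S - \<Theta> * Q)) * \<bar>2 * \<eta>\<bar>"
    proof (rule frob_norm_le_const)
      fix j assume "j < dim_col (S - \<Theta> * Q)"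
      then have j: "j < m" using Q by simp
      have "col (S - \<Theta> * Q) j = col S j - \<Theta> *\<^sub>v col Q j"
        using S Q \<Theta> j by (intro eq_vecI) auto
      then show "vnorm (col (S - \<Theta> * Q) j) \<le> 2 * \<eta>" using colerr(2)[OF j] by simp
    qed
    then show ?thesis using Q \<eta>0 \<eta>v by simp
  qed
  have SQ: "vnorm (S *\<^sub>v x - \<Theta> *\<^sub>v (Q *\<^sub>v x)) \<le> (2/100) * v * vnorm x" if x: "x \<in> carrier_vec m" for x
  proof -
    have "S *\<^sub>v x - \<Theta> *\<^sub>v (Q *\<^sub>v x) = (S - \<Theta> * Q) *\<^sub>v x"
      using S Q \<Theta> x by (subst minus_mult_distrib_mat_vec[of _ k m]) (auto simp: assoc_mult_mat_vec[of _ k n])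
    then have "vnorm (S *\<^sub>v x - \<Theta> *\<^sub>v (Q *\<^sub>v x)) \<le> frob_norm (S - \<Theta> * Q) * vnorm x"
      using vnorm_mult_mat_vec_le[of x "S - \<Theta> * Q"] Q x by simp
    also have "\<dots> \<le> (2/100) * v * vnorm x" using FE by (intro mult_right_mono) auto
    finally show ?thesis .
  qed

  \<comment> \<open>Singular values of \<open>Q\<close>\<close>
  have Slin: "(1 - \<Delta>\<^sub>m) * vnorm x \<le> vnorm (S *\<^sub>v x)" "vnorm (S *\<^sub>v x) \<le> (1 + \<Delta>\<^sub>m) * vnorm x"
    if x: "x \<in> carrier_vec m" for x
  proof -
    \<comment> \<open>As \<open>\<Delta>\<^sub>m\<close> lies between 0 and 1, the bounds on squared
      norms imply bounds on norms with the same factors.\<close>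
    have sq: "(1 - \<Delta>\<^sub>m)\<^sup>2 \<le> 1 - \<Delta>\<^sub>m" "1 + \<Delta>\<^sub>m \<le> (1 + \<Delta>\<^sub>m)\<^sup>2"
      using \<Delta>0 \<Delta>1 mult_left_mono[of "1 - \<Delta>\<^sub>m" 1 "1 - \<Delta>\<^sub>m"]
      by (auto simp: power2_eq_square algebra_simps)
    have "((1 - \<Delta>\<^sub>m) * vnorm x)\<^sup>2 \<le> (1 - \<Delta>\<^sub>m) * (vnorm x)\<^sup>2"
      "(1 + \<Delta>\<^sub>m) * (vnorm x)\<^sup>2 \<le> ((1 + \<Delta>\<^sub>m) * vnorm x)\<^sup>2"
      unfolding power_mult_distrib using sq by (auto intro!: mult_right_mono)
    then have "((1 - \<Delta>\<^sub>m) * vnorm x)\<^sup>2 \<le> (vnorm (S *\<^sub>v x))\<^sup>2"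
      "(vnorm (S *\<^sub>v x))\<^sup>2 \<le> ((1 + \<Delta>\<^sub>m) * vnorm x)\<^sup>2"
      using Sdev[OF x] by (auto simp: abs_le_iff algebra_simps)
    then show "(1 - \<Delta>\<^sub>m) * vnorm x \<le> vnorm (S *\<^sub>v x)" "vnorm (S *\<^sub>v x) \<le> (1 + \<Delta>\<^sub>m) * vnorm x"
      using \<Delta>0 by (auto intro: power2_le_imp_le)
  qed
  have lower: "(1 - \<Delta>\<^sub>m - (1/10) * v) * vnorm x \<le> sqrt (1 + \<epsilon>) * vnorm (Q *\<^sub>v x)"
    and upper: "sqrt (1 - \<epsilon>) * vnorm (Q *\<^sub>v x) \<le> (1 + \<Delta>\<^sub>m + (1/10) * v) * vnorm x"
    if x: "x \<in> carrier_vec m" for x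
  proof -
    have d: "dim_vec (S *\<^sub>v x) = dim_vec (\<Theta> *\<^sub>v (Q *\<^sub>v x))" using S \<Theta> by simp
    have "0 \<le> v * vnorm x" using v0 by simp
    then show "(1 - \<Delta>\<^sub>m - (1/10) * v) * vnorm x \<le> sqrt (1 + \<epsilon>) * vnorm (Q *\<^sub>v x)"
      "sqrt (1 - \<epsilon>) * vnorm (Q *\<^sub>v x) \<le> (1 + \<Delta>\<^sub>m + (1/10) * v) * vnorm x"
      using Slin[OF x] SQ[OF x] lift[OF embQ[OF x]] vnorm_le_add_diff[OF d]
        vnorm_le_add_diff[OF d[symmetric]] vnorm_diff_commute[OF d]
      by (auto simp: algebra_simps)
  qed
  have \<epsilon>1: "0 < 1 - \<epsilon>" using assms(15) by simp
  \<comment> \<open>Otherwise the right-hand side of \<open>lower\<close> is nonpositive, while its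
    left-hand side is positive at a unit vector.\<close>
  have \<epsilon>2: "0 < 1 + \<epsilon>"
  proof (rule ccontr)
    assume "\<not> 0 < 1 + \<epsilon>"
    then have "sqrt (1 + \<epsilon>) * vnorm (Q *\<^sub>v unit_vec m 0) \<le> 0"
      by (intro mult_nonpos_nonneg) auto
    then show False using lower[of "unit_vec m 0"] unit[OF mn(2)] \<Delta>1 v1 by simp
  qed
  have sig: "(1 + \<epsilon>) powr (-1/2) * (1 - \<Delta>\<^sub>m - (1/10) * v) \<le> sigma_min Q"
    "sigma_min Q \<le> sigma_max Q" "sigma_max Q \<le> (1 - \<epsilon>) powr (-1/2) * (1 + \<Delta>\<^sub>m + (1/10) * v)"
    using singular_value_bounds[OF Q mn(2,1), of
        "(1 + \<epsilon>) powr (-1/2) * (1 - \<Delta>\<^sub>m - (1/10) * v)" "(1 - \<epsilon>) powr (-1/2) * (1 + \<Delta>\<^sub>m + (1/10) * v)"]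
      lower upper \<epsilon>1 \<epsilon>2
    unfolding powr_minus_half[OF \<epsilon>1] powr_minus_half[OF \<epsilon>2] by (auto simp: field_simps)

  \<comment> \<open>Frobenius norms of \<open>P\<close>, \<open>R\<close> and
    \<open>Q\<close>\<close>
  have FP: "frob_norm P \<le> (1225/1000) * frob_norm W"
  proof -
    have "frob_norm P \<le> (1225/1000) * frob_norm W + 0 * frob_norm W"
    proof (rule frob_norm_le_cols)
      fix j assume "j < dim_col P"
      then have j: "j < m" using P by simp
      have w: "col W j \<in> carrier_vec n" using W j by simp
      have "sqrt (1 + \<epsilon>) \<le> sqrt (3/2)" using assms(15) by simp
      also have "\<dots> \<le> 12248/10000" by (rule real_le_lsqrt) (simp_all add: power2_eq_square)
      finally have "sqrt (1 + \<epsilon>) * vnorm (col W j) \<le> 12248/10000 * vnorm (col W j)"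
        by (rule mult_right_mono) simp
      moreover have "vnorm (\<Theta> *\<^sub>v col W j) \<le> sqrt (1 + \<epsilon>) * vnorm (col W j)"
        using lift(1)[OF embW[of "unit_vec m j"]] Wcol[OF j] by simp
      moreover have "127/100 * \<eta> * vnorm (col W j) \<le> 1/5000 * vnorm (col W j)"
        using \<eta>1 by (intro mult_right_mono) auto
      moreover have "vnorm (col P j - \<Theta> *\<^sub>v col W j) \<le> 127/100 * \<eta> * vnorm (col W j)"
        using sketch[OF stP[OF j] w] by simp
      moreover have "vnorm (col P j) \<le> vnorm (\<Theta> *\<^sub>v col W j) + vnorm (col P j - \<Theta> *\<^sub>v col W j)"
        using P \<Theta> by (intro vnorm_le_add_diff) simp
      ultimately have "vnorm (col P j) \<le> 1225/1000 * vnorm (col W j)" by linarith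
      then show "vnorm (col P j) \<le> 1225/1000 * vnorm (col W j) + 0 * vnorm (col W j)" by simp
    qed (use P W in auto)
    then show ?thesis by simp
  qed
  have resid: "frob_norm (P - S * R) \<le> (1/10) * frob_norm P"
  proof -
    \<comment> \<open>For \<open>P = 0\<close> the quotient \<open>\<Delta>t\<^sub>m\<close> is \<open>0\<close> and carries no information.\<close>
    have "frob_norm P \<noteq> 0"
    proof
      assume "frob_norm P = 0"
      then have "vnorm (col P 0) = 0"
        using vnorm_col_le_frob_norm[of 0 P] P mn vnorm_nonneg[of "col P 0"] by simp
      moreover have "col S' 0 = col P 0"
        using step[OF mn(2)] by (simp add: rgs_step_def)
      ultimately show False
        using fl_divide_vec_zero[OF stS[OF mn(2)]] Scol_bd(1)[OF mn(2)] by simp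
    qed
    then have "0 < frob_norm P" by (simp add: less_le)
    then show ?thesis using assms(12,17) by (simp add: pos_divide_le_eq)
  qed
  \<comment> \<open>Here 1.0542 slightly exceeds the inverse square root of 0.9, and 1.43 rounds up
    1.0542 * 1.1 * 1.225.\<close>
  have FR: "frob_norm R \<le> (143/100) * frob_norm W"
  proof -
    have "frob_norm (S * R) \<le> 1 * frob_norm P + 1 * frob_norm (P - S * R)"
    proof (rule frob_norm_le_cols)
      fix j assume "j < dim_col (S * R)"
      then have j: "j < m" using R by simp
      have "col (P - S * R) j = col P j - col (S * R) j"
        using P S R j by (intro eq_vecI) auto
      then show "vnorm (col (S * R) j) \<le> 1 * vnorm (col P j) + 1 * vnorm (col (P - S * R) j)"
        using vnorm_le_add_diff[of "col (S * R) j" "col P j"]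
          vnorm_diff_commute[of "col (S * R) j" "col P j"] P S by simp
    qed (use P R in auto)
    moreover have "frob_norm R \<le> 10542/10000 * frob_norm (S * R) + 0 * frob_norm R"
    proof (rule frob_norm_le_cols)
      fix j assume "j < dim_col R"
      then have j: "j < m" using R by simp
      have cS: "col (S * R) j = S *\<^sub>v col R j" using S R j by (intro eq_vecI) auto
      have "9/10 * (vnorm (col R j))\<^sup>2 \<le> (vnorm (S *\<^sub>v col R j))\<^sup>2"
        using Sbd(1)[of "col R j"] R j by simp
      moreover have "(10542/10000 * vnorm (S *\<^sub>v col R j))\<^sup>2
          = 111133764/100000000 * (vnorm (S *\<^sub>v col R j))\<^sup>2"
        by (simp add: power2_eq_square)
      ultimately have "(vnorm (col R j))\<^sup>2 \<le> (10542/10000 * vnorm (S *\<^sub>v col R j))\<^sup>2"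
        using zero_le_power2[of "vnorm (S *\<^sub>v col R j)"] by linarith
      then have "vnorm (col R j) \<le> 10542/10000 * vnorm (S *\<^sub>v col R j)"
        by (rule power2_le_imp_le) simp
      then show "vnorm (col R j) \<le> 10542/10000 * vnorm (col (S * R) j) + 0 * vnorm (col R j)"
        unfolding cS by simp
    qed auto
    ultimately show ?thesis using resid FP frob_norm_nonneg[of W] by linarith
  qed
  have FQ: "frob_norm Q \<le> (149/100) * sqrt m"
    using frob_norm_le_const[of Q "149/100"] colerr(1) Q by simp

  \<comment> \<open>The residual \<open>W - Q * R\<close>\<close>
  have rescol: "vnorm (col (W - Q * R) i)
      \<le> ((102/100) * v) * vnorm (col W i) + ((153/100) * v * (m * sqrt m)) * vnorm (col R i)"
    if i: "i < m" for i
  proof -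
    have ri: "r i \<in> carrier_vec i" by (simp add: r_def)
    have "col (W - Q * R) i = col W i - Q *\<^sub>v col R i"
      using W Q R i by (intro eq_vecI) auto
    also have "Q *\<^sub>v col R i = first_cols Q i *\<^sub>v r i + R $$ (i, i) \<cdot>\<^sub>v col Q i"
      unfolding r_def by (rule mult_upper_triangular_col[OF Q R i])
    \<comment> \<open>Because the diagonal entry is nonzero,
      \<open>R $$ (i, i) \<cdot>\<^sub>v h i\<close> is \<open>col Q' i\<close>, which cancels
      between the two local errors.\<close>
    also have "col W i - \<dots> = (-1) \<cdot>\<^sub>v dq' i + (- R $$ (i, i)) \<cdot>\<^sub>v (col Q i - h i)"
      using W Q Q' i Rnz[OF i]
      by (intro eq_vecI) (auto simp: dq'_def h_def first_cols_def algebra_simps)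
    finally have "vnorm (col (W - Q * R) i)
        \<le> vnorm ((-1) \<cdot>\<^sub>v dq' i) + vnorm ((- R $$ (i, i)) \<cdot>\<^sub>v (col Q i - h i))"
      using Q Q' W by (auto simp: dq'_def h_def first_cols_def intro!: vnorm_add_le)
    then have res: "vnorm (col (W - Q * R) i)
        \<le> vnorm (dq' i) + \<bar>R $$ (i, i)\<bar> * vnorm (col Q i - h i)"
      by (simp only: vnorm_smult) simp
    have ge: "real m * sqrt m \<ge> 1" using mult_mono[of 1 "real m" 1 "sqrt m"] m sm by simp

    have "vnorm (col Q i - h i) \<le> u * (3/2)"
      using dq[OF i] hbd[OF i] u0 mult_left_mono[of "vnorm (h i)" "3/2" u] by simp
    moreover have "\<bar>R $$ (i, i)\<bar> \<le> vnorm (col R i)"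
      using abs_index_le_vnorm[of i "col R i"] R i by simp
    ultimately have "\<bar>R $$ (i, i)\<bar> * vnorm (col Q i - h i) \<le> vnorm (col R i) * (u * (3/2))"
      by (intro mult_mono) auto
    also have "\<dots> \<le> vnorm (col R i) * (1/10000 * v * (m * sqrt m))"
    proof (rule mult_left_mono)
      have "u * (3/2) \<le> 1/10000 * v * 1" using u\<eta> \<eta>v' u0 by linarith
      also have "\<dots> \<le> 1/10000 * v * (m * sqrt m)" using ge v0 by (intro mult_left_mono) auto
      finally show "u * (3/2) \<le> 1/10000 * v * (m * sqrt m)" .
    qed simp
    finally have t1: "\<bar>R $$ (i, i)\<bar> * vnorm (col Q i - h i)
        \<le> 1/10000 * (v * (m * sqrt m) * vnorm (col R i))" by (simp add: mult_ac)

    have "vnorm (map_mat abs (first_cols Q i) *\<^sub>v map_vec abs (r i))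
        \<le> frob_norm (first_cols Q i) * vnorm (r i)"
      using vnorm_mult_mat_vec_le[of "map_vec abs (r i)" "map_mat abs (first_cols Q i)"] ri
      by (simp add: frob_norm_abs vnorm_abs first_cols_def)
    also have "\<dots> \<le> ((149/100) * sqrt m) * vnorm (col R i)"
    proof (rule mult_mono)
      show "frob_norm (first_cols Q i) \<le> (149/100) * sqrt m"
        using frob_norm_first_cols_le[of i Q] FQ Q i by simp
      show "vnorm (r i) \<le> vnorm (col R i)"
        unfolding r_def using R i by (intro vnorm_vec_first_le) simp
    qed auto
    \<comment> \<open>Origin of the exponent 3/2: \<open>Suc i\<close> is at most \<open>m\<close>,
      and the norm of \<open>Q\<close> supplies \<open>sqrt m\<close>.\<close>
    finally have "real (Suc i) * vnorm (map_mat abs (first_cols Q i) *\<^sub>v map_vec abs (r i))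
        \<le> real m * (((149/100) * sqrt m) * vnorm (col R i))"
      using i by (intro mult_mono) auto
    moreover have "vnorm (b i) \<le> vnorm (col W i)
        + real (Suc i) * vnorm (map_mat abs (first_cols Q i) *\<^sub>v map_vec abs (r i))"
    proof -
      have "vnorm (b i) \<le> vnorm (map_vec abs (col W i))
          + vnorm (real (Suc i) \<cdot>\<^sub>v (map_mat abs (first_cols Q i) *\<^sub>v map_vec abs (r i)))"
        unfolding b_def using W Q by (intro vnorm_add_le) (simp add: first_cols_def)
      then show ?thesis by (simp only: vnorm_smult vnorm_abs)
    qed
    ultimately have "vnorm (b i) \<le> vnorm (col W i) + (149/100) * (m * sqrt m * vnorm (col R i))"
      by (simp add: mult_ac)
    then have "(102/100) * v * vnorm (b i)
        \<le> (102/100) * v * (vnorm (col W i) + (149/100) * (m * sqrt m * vnorm (col R i)))"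
      using v0 by (intro mult_left_mono) auto
    then have "vnorm (dq' i) \<le> (102/100) * v * vnorm (col W i)
        + 15198/10000 * (v * (m * sqrt m) * vnorm (col R i))"
      using dq'b[OF i] by (simp add: algebra_simps)
    moreover have "0 \<le> v * (m * sqrt m) * vnorm (col R i)" using v0 by simp
    ultimately have "vnorm (col (W - Q * R) i) \<le> (102/100) * v * vnorm (col W i)
        + 153/100 * (v * (m * sqrt m) * vnorm (col R i))"
      using res t1 by linarith
    then show ?thesis by (simp only: mult.assoc)
  qed
  have "frob_norm (W - Q * R) \<le> ((102/100) * v) * frob_norm W + ((153/100) * v * (m * sqrt m)) * frob_norm R"
    by (rule frob_norm_le_cols) (use rescol W R v0 in auto)
  also have "\<dots> \<le> ((102/100) * v) * frob_norm W + ((153/100) * v * (m * sqrt m)) * ((143/100) * frob_norm W)"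
    using FR v0 by (intro add_left_mono mult_left_mono) auto
  also have "\<dots> \<le> (102/100) * v * (m * sqrt m) * frob_norm W + ((153/100) * v * (m * sqrt m)) * ((143/100) * frob_norm W)"
  proof -
    have "1 * 1 \<le> m * sqrt m" using m sm by (intro mult_mono) auto
    then have "(102/100) * v * 1 * frob_norm W \<le> (102/100) * v * (m * sqrt m) * frob_norm W"
      using v0 by (intro mult_right_mono mult_left_mono) auto
    then show ?thesis by (simp add: mult_ac)
  qed
  \<comment> \<open>The constant is 1.02 + 1.53 * 1.43.\<close>
  also have "\<dots> = (32079/10000) * (v * (m * sqrt m) * frob_norm W)" by (simp add: algebra_simps)
  also have "\<dots> \<le> (37/10) * (v * (m * sqrt m) * frob_norm W)"
    using v0 by (intro mult_right_mono) auto
  also have "\<dots> = (37/10) * v * real m powr (3/2) * frob_norm W"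
    using m by (simp add: powr_three_halves)
  finally show ?thesis using sig unfolding v_def by simp
qed

end
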